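(* Let $\alpha$ be a nonzero algebraic number and $0<a<b<\infty$. Then $[a,b]$ is $\alpha$-uniform if and only if every point of $(a,b)$ is $\alpha$-standard. Moreover, $(0,a]$ is $\alpha$-uniform if and only if every point of $(0,a)$ is $\alpha$-standard.
   Context: For a nonzero algebraic number $\alpha$, $M(\alpha)$ is the logarithmic Mahler measure of its minimal polynomial $a\prod_n(z-\alpha_n)$ over $\mathbb Z$: $M(\alpha)=\log|a|+\sum_n\log^+|\alpha_n|$. For $t\in(0,\infty)$, $M_t(\alpha)=\inf(\sum_{n=1}^N M(\alpha_n)^t)^{1/t}$ and $M_\infty(\alpha)=\inf\max_n M(\alpha_n)$, the infima taken over all factorizations $\alpha=\alpha_1\cdots\alpha_N$ with $\alpha_n\in\overline{\mathbb Q}^{\times}$. Set $\mu_\alpha(t)=M_t(\alpha)$ for $t\in(0,\infty]$. Let $\mathcal X(\mathbb R)$ be the set of real sequences $\mathbf x=(x_1,x_2,\dots)$ with $x_n=0$ for all but finitely many $n$, and put $\|\mathbf x\|_t=(\sum_n|x_n|^t)^{1/t}$ for $t\in(0,\infty)$, $\|\mathbf x\|_\infty=\max_n|x_n|$. A set $I\subseteq(0,\infty]$ is $\alpha$-uniform if there is $\mathbf x\in\mathcal X(\mathbb R)$ with $\mu_\alpha(t)=\|\mathbf x\|_t$ for all $t\in I$. A point $s\in(0,\infty]$ is $\alpha$-standard if it has an $\alpha$-uniform open neighborhood, and $\alpha$-exceptional otherwise. *)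

theory Defs
  imports "HOL-Analysis.Analysis" "HOL-Computational_Algebra.Computational_Algebra"
begin

text \<open>The algebraic closure of the rationals is realised as the set of algebraic complex numbers.
  Irreducibility is meant in \<open>\<int>[x]\<close>, so it includes primitivity; the sign of the leading
  coefficient then makes the minimal polynomial unique, see \<open>ex1_min_int_poly\<close>.\<close>

definition is_min_int_poly :: "complex \<Rightarrow> int poly \<Rightarrow> bool" where
  "is_min_int_poly \<alpha> p \<longleftrightarrow>
     irreducible p \<and> lead_coeff p > 0 \<and> poly (map_poly of_int p) \<alpha> = 0"

definition min_int_poly :: "complex \<Rightarrow> int poly" where
  "min_int_poly \<alpha> = (THE p. is_min_int_poly \<alpha> p)"

definition log_plus :: "real \<Rightarrow> real" where
  "log_plus x = max 0 (ln x)"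

definition mahler :: "complex \<Rightarrow> real" where
  "mahler \<alpha> =
     ln \<bar>real_of_int (lead_coeff (min_int_poly \<alpha>))\<bar>
     + (\<Sum>z\<in>#proots (map_poly of_int (min_int_poly \<alpha>) :: complex poly). log_plus (cmod z))"

definition factorizations :: "complex \<Rightarrow> complex list set" where
  "factorizations \<alpha> =
     {\<beta>s. \<beta>s \<noteq> [] \<and> (\<forall>\<beta>\<in>set \<beta>s. algebraic \<beta> \<and> \<beta> \<noteq> 0) \<and> prod_list \<beta>s = \<alpha>}"

text \<open>The parameter ranges over \<open>{0<..} :: ereal set\<close>, that is \<open>(0,\<infinity>]\<close>; values at
  \<open>t \<le> 0\<close> are irrelevant.\<close>

definition metric_mahler :: "ereal \<Rightarrow> complex \<Rightarrow> real" where
  "metric_mahler t \<alpha> =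
     (if t = \<infinity> then INF \<beta>s\<in>factorizations \<alpha>. Max (mahler ` set \<beta>s)
      else INF \<beta>s\<in>factorizations \<alpha>.
             (\<Sum>\<beta>\<leftarrow>\<beta>s. mahler \<beta> powr real_of_ereal t) powr (1 / real_of_ereal t))"

definition fin_seqs :: "(nat \<Rightarrow> real) set" where
  "fin_seqs = {x. finite {n. x n \<noteq> 0}}"

definition seq_norm :: "ereal \<Rightarrow> (nat \<Rightarrow> real) \<Rightarrow> real" where
  "seq_norm t x =
     (if t = \<infinity> then Max (range (\<lambda>n. \<bar>x n\<bar>))
      else (\<Sum>n | x n \<noteq> 0. \<bar>x n\<bar> powr real_of_ereal t) powr (1 / real_of_ereal t))"

definition uniform_set :: "complex \<Rightarrow> ereal set \<Rightarrow> bool" where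
  "uniform_set \<alpha> I \<longleftrightarrow>
     I \<subseteq> {0<..} \<and> (\<exists>x\<in>fin_seqs. \<forall>t\<in>I. metric_mahler t \<alpha> = seq_norm t x)"

text \<open>As \<open>{0<..}\<close> is open in \<^typ>\<open>ereal\<close>, its relatively open subsets are exactly the open
  sets of \<^typ>\<open>ereal\<close> contained in it.\<close>

definition standard_point :: "complex \<Rightarrow> ereal \<Rightarrow> bool" where
  "standard_point \<alpha> s \<longleftrightarrow> (\<exists>U. open U \<and> s \<in> U \<and> uniform_set \<alpha> U)"

lemma map_poly_of_int_mult:
  "(map_poly of_int (p * q) :: complex poly) = map_poly of_int p * map_poly of_int q"
  by (intro poly_eqI) (simp add: coeff_map_poly coeff_mult)

lemma map_poly_of_int_add:
  "(map_poly of_int (p + q) :: complex poly) = map_poly of_int p + map_poly of_int q"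
  by (intro poly_eqI) (simp add: coeff_map_poly)

lemma map_poly_of_int_smult:
  "(map_poly of_int (smult c q) :: complex poly) = smult (of_int c) (map_poly of_int q)"
  by (intro poly_eqI) (simp add: coeff_map_poly)

lemma irreducible_root_dvd:
  fixes p q :: "int poly" and \<alpha> :: complex
  assumes p: "irreducible p" "poly (map_poly of_int p) \<alpha> = 0"
    and q: "poly (map_poly of_int q) \<alpha> = 0"
  shows "p dvd q"
proof -
  define R where "R = (\<lambda>m::int poly. m \<noteq> 0 \<and> poly (map_poly of_int m) \<alpha> = 0)"
  have p0: "p \<noteq> 0" using p by auto
  have "R p" using p p0 by (simp add: R_def)
  then obtain m where m: "R m" and mmin: "\<And>k. R k \<Longrightarrow> degree m \<le> degree k"
    using ex_has_least_nat[of R p degree] by blast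
  have m0: "m \<noteq> 0" using m by (simp add: R_def)
  have degm: "degree m \<noteq> 0"
  proof
    assume "degree m = 0"
    then obtain c where "m = [:c:]" by (metis degree_eq_zeroE)
    with m show False by (auto simp: R_def map_poly_pCons)
  qed
  have div: "\<exists>c s. c \<noteq> 0 \<and> smult c f = m * s"
    if f: "poly (map_poly of_int f) \<alpha> = 0" for f :: "int poly"
  proof -
    obtain c s where cs: "c \<noteq> 0" "smult c f = m * s + pseudo_mod f m"
      using pseudo_mod(1)[OF m0] by blast
    have "poly (map_poly of_int (smult c f)) \<alpha> = 0"
      using f by (simp add: map_poly_of_int_smult)
    hence "poly (map_poly of_int (pseudo_mod f m)) \<alpha> = 0"
      using m by (simp add: cs(2) map_poly_of_int_add map_poly_of_int_mult R_def)
    hence "pseudo_mod f m = 0"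
      using pseudo_mod(2)[OF m0, of f] mmin[of "pseudo_mod f m"] by (force simp: R_def)
    thus ?thesis using cs by auto
  qed
  have prime: "prime_elem p" using p prime_elem_iff_irreducible by blast
  obtain c s where cs: "c \<noteq> 0" "smult c p = m * s" using div p by blast
  have "p dvd m * s" using cs(2) by (metis dvd_refl dvd_smult)
  hence "p dvd m \<or> p dvd s" using prime prime_elem_dvd_mult_iff by blast
  moreover have "\<not> p dvd s"
  proof
    assume "p dvd s"
    then obtain k where k: "s = p * k" by blast
    have "p * [:c:] = p * (m * k)" using cs(2) k by (simp add: ac_simps)
    hence e: "[:c:] = m * k" using p0 by (metis mult_left_cancel)
    hence "k \<noteq> 0" using cs(1) by auto
    hence "degree [:c:] = degree m + degree k" using e m0 by (metis degree_mult_eq)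
    thus False using degm by simp
  qed
  ultimately have pm: "p dvd m" by blast
  obtain d t where dt: "d \<noteq> 0" "smult d q = m * t" using div q by blast
  have "p dvd [:d:] * q" using pm dt(2) by simp
  moreover have "\<not> p dvd [:d:]"
  proof
    assume "p dvd [:d:]"
    then obtain k where k: "[:d:] = p * k" by blast
    have "poly (map_poly of_int [:d:]) \<alpha> = 0" using p by (simp add: k map_poly_of_int_mult)
    thus False using dt(1) by (simp add: map_poly_pCons)
  qed
  ultimately show ?thesis using prime prime_elem_dvd_mult_iff by blast
qed

lemma ex1_min_int_poly:
  assumes "algebraic \<alpha>"
  shows "\<exists>!p. is_min_int_poly \<alpha> p"
proof (rule ex_ex1I)
  obtain P :: "complex poly" where P: "\<And>i. coeff P i \<in> \<int>" "P \<noteq> 0" "poly P \<alpha> = 0"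
    using assms by (elim algebraicE) blast
  define f where "f = (\<lambda>z::complex. \<lfloor>Re z\<rfloor>)"
  define q where "q = map_poly f P"
  have q: "P = map_poly of_int q"
  proof (rule poly_eqI)
    fix i
    obtain n :: int where "coeff P i = of_int n" using P(1) by (metis Ints_cases)
    thus "coeff P i = coeff (map_poly of_int q) i"
      by (simp add: q_def f_def coeff_map_poly)
  qed
  have q0: "q \<noteq> 0" using P(2) q by auto
  let ?z = "\<lambda>p::int poly. poly (map_poly of_int p :: complex poly) \<alpha> = 0"
  have "\<exists>p. prime_elem p \<and> ?z p"
    using q0 P(3)[unfolded q]
  proof (induction q rule: prime_divisors_induct)
    case zero thus ?case by simp
  next
    case (unit u)
    then obtain c where c: "u = [:c:]" "c dvd 1" by (auto simp: is_unit_poly_iff)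
    hence "c = 0" using unit by (simp add: map_poly_pCons)
    thus ?case using c by simp
  next
    case (factor p x)
    from factor.prems have "?z p \<or> ?z x" "x \<noteq> 0" by (auto simp: map_poly_of_int_mult)
    thus ?case using factor by (auto simp: prime_imp_prime_elem)
  qed
  then obtain p where p: "prime_elem p" "?z p" by blast
  hence ip: "irreducible p" by (simp add: prime_elem_iff_irreducible)
  show "\<exists>p. is_min_int_poly \<alpha> p"
  proof (cases "lead_coeff p > 0")
    case True thus ?thesis using ip p by (auto simp: is_min_int_poly_def)
  next
    case False
    have "lead_coeff p \<noteq> 0" using p by auto
    hence "lead_coeff p < 0" using False by linarith
    hence "lead_coeff (- p) > 0" by simp
    moreover have "irreducible (- p)" 
      using ip irreducible_mult_unit_left[of "-1" p] by simp
    moreover have "?z (- p)"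
      using map_poly_of_int_smult[of "-1" p] p by simp
    ultimately show ?thesis unfolding is_min_int_poly_def by blast
  qed
next
  fix p q assume pq: "is_min_int_poly \<alpha> p" "is_min_int_poly \<alpha> q"
  hence dvd: "p dvd q" "q dvd p" by (auto simp: is_min_int_poly_def intro: irreducible_root_dvd)
  then obtain k where k: "q = p * k" by blast
  have p0: "p \<noteq> 0" using pq by (auto simp: is_min_int_poly_def)
  have "p * k dvd p * 1" using dvd k by simp
  hence "k dvd 1" using p0 by (metis dvd_times_left_cancel_iff)
  then obtain c where c: "k = [:c:]" "c dvd 1" by (auto simp: is_unit_poly_iff)
  have "lead_coeff q = lead_coeff p * c" using k c by (simp add: lead_coeff_mult)
  hence "c > 0" using pq by (simp add: is_min_int_poly_def zero_less_mult_iff)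
  hence "c = 1" using c by (simp add: zdvd1_eq)
  thus "p = q" using k c by simp
qed

end

theory Submission
  imports Defs "Jordan_Normal_Form.Char_Poly" "HOL-Complex_Analysis.Conformal_Mappings"
begin

text \<open>On an interval of standard points the sequences representing \<open>\<mu>\<^sub>\<alpha>\<close> locally have the same
  norm functions, since a power sum is an exponential polynomial in \<open>t\<close> and so is determined by its
  values on any interval; hence one sequence represents \<open>\<mu>\<^sub>\<alpha>\<close> on the whole open interval. It
  remains to see that \<open>\<mu>\<^sub>\<alpha>\<close> is continuous at the end points. As an infimum of nonincreasing
  continuous functions it is continuous from the left.

  Continuity from the right is arithmetic. Let \<open>K\<close> be the splitting field of \<open>\<alpha>\<close> and let
  \<open>\<alpha> = \<beta>\<^sub>1 \<cdots> \<beta>\<^sub>n\<close>. Let \<open>N \<beta>\<close> be the product of the \<open>m\<close> conjugates of \<open>\<beta>\<close> over \<open>K\<close>. Replacing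
  each \<open>\<beta>\<^sub>i\<close> by an \<open>m\<^sub>i\<close>-th root \<open>z\<^sub>i\<close> of \<open>N \<beta>\<^sub>i\<close> changes the product by a root of unity only. If the
  minimal polynomial of \<open>\<beta>\<close> has leading coefficient \<open>a\<close>, then \<open>a \<Prod>\<^sub>B (X\<^sup>m - \<Prod>B)\<close>, with \<open>B\<close> running
  through the classes of conjugates over \<open>K\<close>, has integer coefficients, the root \<open>z\<close>, and Mahler
  measure at most \<open>M(\<beta>)\<close>; so \<open>M(z) \<le> M(\<beta>)\<close>. Moreover \<open>M(z) \<ge> M(N z)\<close>, and \<open>N z \<in> K\<close> has bounded
  degree, so by Northcott the positive values of \<open>M(z)\<close> are bounded below by some \<open>c > 0\<close>. Then
  \<open>\<Sum> M(z\<^sub>i)\<^sup>s \<le> c\<^bsup>s-t\<^esup> \<Sum> M(z\<^sub>i)\<^sup>t\<close> for \<open>s \<le> t\<close>, which gives the continuity.\<close>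

section \<open>Algebraic integers\<close>

hide_const (open) Module.smult

section \<open>Multiplier rings of finitely generated subgroups of the complex numbers\<close>

interpretation int_span: Modules.module "\<lambda>(k::int) (x::complex). of_int k * x"
  by unfold_locales (auto simp: algebra_simps)

abbreviation zspan :: "complex set \<Rightarrow> complex set" where
  "zspan \<equiv> int_span.span"

text \<open>The multiplier ring of the group generated by \<open>B\<close>, tested on generators
  only. For finite \<open>B\<close> containing 1 it consists of algebraic integers, and any finitely
  many algebraic integers lie in one such ring. Closure under sums and products follows.\<close>

definition stab :: "complex set \<Rightarrow> complex set" where
  "stab B = {z. \<forall>b\<in>B. z * b \<in> zspan B}"

lemma stab_mult_zspan:
  assumes "z \<in> stab B" and "x \<in> zspan B"
  shows "z * x \<in> zspan B"
  using assms(2)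
proof (induction rule: int_span.span_induct_alt)
  case base
  show ?case by (simp add: int_span.span_zero)
next
  case (step c x y)
  have "z * x \<in> zspan B" using step(1) assms(1) by (auto simp: stab_def)
  hence "of_int c * (z * x) + z * y \<in> zspan B"
    using step by (intro int_span.span_add int_span.span_scale)
  thus ?case by (simp add: algebra_simps)
qed

lemma stab_0: "0 \<in> stab B"
  by (auto simp: stab_def int_span.span_zero)

lemma stab_plus: "x \<in> stab B \<Longrightarrow> y \<in> stab B \<Longrightarrow> x + y \<in> stab B"
  by (auto simp: stab_def distrib_right int_span.span_add)

lemma stab_mult:
  assumes "x \<in> stab B" and "y \<in> stab B"
  shows "x * y \<in> stab B"
proof -
  have "x * (y * b) \<in> zspan B" if "b \<in> B" for b
    using assms(2) that by (intro stab_mult_zspan[OF assms(1)]) (simp add: stab_def)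
  thus ?thesis by (simp add: stab_def mult.assoc)
qed

lemma stab_Ints: "x \<in> \<int> \<Longrightarrow> x \<in> stab B"
  by (auto simp: stab_def int_span.span_scale int_span.span_base elim!: Ints_cases)

text \<open>An eigenvalue of an integer matrix is a root of its characteristic polynomial, which is
  monic with integer coefficients. The entry \<open>v k\<close> only ensures that the eigenvector is
  nonzero.\<close>

lemma algebraic_int_eigenvalue:
  fixes z :: complex and v :: "nat \<Rightarrow> complex" and A :: "nat \<Rightarrow> nat \<Rightarrow> int"
  assumes ev: "\<And>i. i < n \<Longrightarrow> z * v i = (\<Sum>j<n. of_int (A i j) * v j)"
    and nz: "k < n" "v k \<noteq> 0"
  shows "algebraic_int z"
proof -
  define M where "M = mat n n (\<lambda>(i, j). A i j)"
  have M: "M \<in> carrier_mat n n" by (simp add: M_def)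
  let ?M = "map_mat complex_of_int M"
  have M': "?M \<in> carrier_mat n n" using M by simp
  have "eigenvector ?M (vec n v) z"
    unfolding eigenvector_def
  proof (intro conjI)
    show "vec n v \<noteq> 0\<^sub>v (dim_row ?M)"
      using nz by (metis M carrier_matD(1) index_map_mat(2) index_vec index_zero_vec(1))
    show "?M *\<^sub>v vec n v = z \<cdot>\<^sub>v vec n v"
      by (rule eq_vecI) (auto simp: M_def scalar_prod_def ev atLeast0LessThan)
  qed (simp add: M_def)
  hence "poly (char_poly ?M) z = 0"
    using eigenvalue_root_char_poly[OF M'] by (auto simp: eigenvalue_def)
  hence "poly (map_poly of_int (char_poly M)) z = 0"
    by (simp add: of_int_hom.char_poly_hom[OF M])
  moreover have "lead_coeff (char_poly M) = 1"
    using degree_monic_char_poly[OF M] by simp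
  ultimately show ?thesis by (auto simp: algebraic_int_altdef_ipoly)
qed

text \<open>Multiplication by \<open>z\<close> acts on the generators through an integer matrix,
  with the vector of generators as eigenvector; the generator 1 is its nonzero entry.\<close>

lemma algebraic_int_stab:
  assumes "finite B" and "1 \<in> B" and "z \<in> stab B"
  shows "algebraic_int z"
proof -
  obtain f where f: "bij_betw f {..<card B} B"
    using ex_bij_betw_nat_finite[OF assms(1)] by (auto simp: atLeast0LessThan)
  have "\<exists>u. z * b = (\<Sum>c\<in>B. of_int (u c) * c)" if "b \<in> B" for b
    using assms(1,3) that by (auto simp: stab_def int_span.span_finite)
  then obtain u where u: "\<And>b. b \<in> B \<Longrightarrow> z * b = (\<Sum>c\<in>B. of_int (u b c) * c)"
    by metis
  have "1 \<in> f ` {..<card B}" using assms(2) f by (simp add: bij_betw_def)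
  then obtain k where "k < card B" "f k = 1" by auto
  moreover have "z * f i = (\<Sum>j<card B. of_int (u (f i) (f j)) * f j)" if "i < card B" for i
    using u[of "f i"] sum.reindex_bij_betw[OF f, of "\<lambda>c. of_int (u (f i) c) * c"] f that
    by (auto simp: bij_betw_def)
  ultimately show ?thesis
    by (intro algebraic_int_eigenvalue[of "card B" z f "\<lambda>i j. u (f i) (f j)" k]) auto
qed

text \<open>Generators of L + L y + ... + L y^(n-1), where L is the group spanned by
  \<open>B\<close>.\<close>

definition adjoin_powers :: "complex set \<Rightarrow> complex \<Rightarrow> nat \<Rightarrow> complex set" where
  "adjoin_powers B y n = (\<lambda>(b, i). b * y ^ i) ` (B \<times> {..<n})"

lemma finite_adjoin_powers: "finite B \<Longrightarrow> finite (adjoin_powers B y n)"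
  by (simp add: adjoin_powers_def)

lemma one_in_adjoin_powers: "1 \<in> B \<Longrightarrow> n > 0 \<Longrightarrow> 1 \<in> adjoin_powers B y n"
  by (force simp: adjoin_powers_def)

lemma zspan_adjoin_powers:
  assumes "x \<in> zspan B" and "j < n"
  shows "x * y ^ j \<in> zspan (adjoin_powers B y n)"
  using assms(1)
proof (induction rule: int_span.span_induct_alt)
  case base
  show ?case by (simp add: int_span.span_zero)
next
  case (step c b x)
  have "b * y ^ j \<in> adjoin_powers B y n" using step assms(2) by (auto simp: adjoin_powers_def)
  hence "of_int c * (b * y ^ j) + x * y ^ j \<in> zspan (adjoin_powers B y n)"
    using step by (intro int_span.span_add int_span.span_scale int_span.span_base[of "b * y ^ j"])
  thus ?case by (simp add: algebra_simps)
qed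

lemma stab_adjoin_powersI:
  assumes "\<And>b j. b \<in> B \<Longrightarrow> j < n \<Longrightarrow> z * y ^ j * b \<in> zspan (adjoin_powers B y n)"
  shows "z \<in> stab (adjoin_powers B y n)"
  using assms by (auto simp: stab_def adjoin_powers_def mult_ac)

lemma stab_mult_power:
  assumes "x \<in> stab B" and "b \<in> B" and "j < n"
  shows "x * y ^ j * b \<in> zspan (adjoin_powers B y n)"
  using zspan_adjoin_powers[of "x * b" B j n y] assms
  by (auto simp: stab_def mult_ac)

lemma stab_subset_adjoin_powers: "stab B \<subseteq> stab (adjoin_powers B y n)"
  by (auto intro!: stab_adjoin_powersI stab_mult_power)

text \<open>Take for \<open>n\<close> the degree of a monic integer equation of \<open>y\<close>.
  Multiplication by \<open>y\<close> leaves the range of exponents only at y^(n-1), and there the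
  equation brings it back.\<close>

lemma algebraic_int_stab_adjoin_powers:
  assumes "algebraic_int y"
  obtains n where "n > 0" and "y \<in> stab (adjoin_powers B y n)"
proof -
  obtain p where p: "lead_coeff p = 1" "\<forall>i. coeff p i \<in> \<int>" "poly p y = 0"
    using assms by (auto simp: algebraic_int.simps)
  define n where "n = degree p"
  have n: "n > 0"
    using p by (intro Nat.gr0I) (auto simp: n_def elim!: degree_eq_zeroE)
  have "0 = (\<Sum>i\<le>n. coeff p i * y ^ i)" using p by (simp add: poly_altdef n_def)
  also have "{..n} = insert n {..<n}" by auto
  finally have yn: "y ^ n = (\<Sum>i<n. (- coeff p i) * y ^ i)"
    using p by (simp add: n_def sum_negf eq_neg_iff_add_eq_0)
  have "y * y ^ j * b \<in> zspan (adjoin_powers B y n)" if "b \<in> B" "j < n" for b j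
  proof (cases "Suc j < n")
    case True
    thus ?thesis
      using stab_mult_power[of 1 B b "Suc j" n y] that stab_Ints[of 1 B] by simp
  next
    case False
    hence "n = Suc j" using that by simp
    hence "y * y ^ j * b = (\<Sum>i<n. (- coeff p i) * y ^ i * b)"
      using arg_cong[OF yn, of "\<lambda>w. w * b"] by (simp only: sum_distrib_right power_Suc)
    also have "\<dots> \<in> zspan (adjoin_powers B y n)"
      using p that by (intro int_span.span_sum stab_mult_power stab_Ints) auto
    finally show ?thesis .
  qed
  thus thesis using n that stab_adjoin_powersI by blast
qed

text \<open>The numbers are adjoined one at a time; by \<open>stab_subset_adjoin_powers\<close> the
  earlier ones remain multipliers.\<close>

lemma algebraic_ints_stab:
  assumes "finite C" and "\<And>c. c \<in> C \<Longrightarrow> algebraic_int c"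
  shows "\<exists>B. finite B \<and> 1 \<in> B \<and> C \<subseteq> stab B"
  using assms
proof (induction rule: finite_induct)
  case empty
  show ?case by (intro exI[of _ "{1}"]) auto
next
  case (insert c C)
  then obtain B where B: "finite B" "1 \<in> B" "C \<subseteq> stab B" by auto
  obtain n where n: "n > 0" "c \<in> stab (adjoin_powers B c n)"
    by (rule algebraic_int_stab_adjoin_powers[of c B]) (use insert.prems in auto)
  show ?case
    using B n stab_subset_adjoin_powers[of B c n]
    by (intro exI[of _ "adjoin_powers B c n"])
      (auto simp: finite_adjoin_powers one_in_adjoin_powers)
qed

lemma algebraic_int_plus_complex:
  fixes x y :: complex
  assumes "algebraic_int x" and "algebraic_int y"
  shows "algebraic_int (x + y)"
proof -
  obtain B where "finite B" "1 \<in> B" "{x, y} \<subseteq> stab B"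
    using algebraic_ints_stab[of "{x, y}"] assms by auto
  thus ?thesis using stab_plus algebraic_int_stab by simp
qed

lemma algebraic_int_times_complex:
  fixes x y :: complex
  assumes "algebraic_int x" and "algebraic_int y"
  shows "algebraic_int (x * y)"
proof -
  obtain B where "finite B" "1 \<in> B" "{x, y} \<subseteq> stab B"
    using algebraic_ints_stab[of "{x, y}"] assms by auto
  thus ?thesis using stab_mult algebraic_int_stab by simp
qed

lemma algebraic_int_power_complex:
  fixes x :: complex
  shows "algebraic_int x \<Longrightarrow> algebraic_int (x ^ n)"
  by (induction n) (auto intro: algebraic_int_times_complex int_imp_algebraic_int)

text \<open>Every coefficient of the quotient stabilises the module generated by the powers of \<open>\<alpha>\<close>
  below the degree of \<open>(X - \<alpha>) q\<close>, over a ring containing the coefficients of \<open>(X - \<alpha>) q\<close>.\<close>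

lemma algebraic_int_coeff_linear_quotient:
  fixes q :: "complex poly"
  assumes f: "\<And>i. algebraic_int (coeff ([:-\<alpha>, 1:] * q) i)"
  shows "algebraic_int (coeff q k)"
proof (cases "q = 0")
  case True
  thus ?thesis by simp
next
  case False
  define F where "F = [:-\<alpha>, 1:] * q"
  define n where "n = Suc (degree q)"
  have F0: "coeff F 0 = - \<alpha> * coeff q 0"
    and FS: "coeff F (Suc i) = coeff q i - \<alpha> * coeff q (Suc i)" for i
    by (auto simp: F_def)
  obtain B where B: "finite B" "1 \<in> B" "coeff F ` {..n} \<subseteq> stab B"
    using algebraic_ints_stab[of "coeff F ` {..n}"] f by (auto simp: F_def)
  have "coeff F i \<in> stab B" for i
  proof (cases "i \<le> n")
    case False
    hence "coeff F i = 0" using F0 FS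
      by (cases i) (auto simp: n_def coeff_eq_0)
    thus ?thesis by (simp add: stab_0)
  qed (use B in auto)
  note FB = stab_mult_power[OF this, where n = n and y = \<alpha>]
  let ?V = "zspan (adjoin_powers B \<alpha> n)"
  \<comment> \<open>For coefficients, q_k = F_(k+1) + \<alpha> q_(k+1). If j \<le> k, this raises j
    and k together until k exceeds the degree of \<open>q\<close>.\<close>
  have lo: "coeff q k * \<alpha> ^ j * b \<in> ?V" if b: "b \<in> B" and jk: "j \<le> k" for j k b
  proof (cases "k < n")
    case True
    hence "k \<le> n" by simp
    thus ?thesis using jk
    proof (induction arbitrary: j rule: inc_induct)
      case base
      show ?case by (simp add: n_def coeff_eq_0 int_span.span_zero)
    next
      case (step k)
      have "coeff q k * \<alpha> ^ j * b = coeff F (Suc k) * \<alpha> ^ j * b + coeff q (Suc k) * \<alpha> ^ Suc j * b"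
        by (simp add: FS algebra_simps)
      also have "\<dots> \<in> ?V"
        using step.hyps step.prems b step.IH[of "Suc j"]
        by (intro int_span.span_add FB) (simp_all del: power_Suc)
      finally show ?case .
    qed
  qed (simp add: n_def coeff_eq_0 int_span.span_zero)
  \<comment> \<open>If j > k, the same relation in the form \<alpha> q_k = q_(k-1) - F_k lowers j
    and k together, ending with \<alpha> q_0 = - F_0.\<close>
  have hi: "coeff q k * \<alpha> ^ j * b \<in> ?V" if b: "b \<in> B" and "k < j" "j < n" for j k b
    using that(2,3)
  proof (induction k arbitrary: j)
    case 0
    then obtain i where i: "j = Suc i" by (cases j) auto
    have "coeff q 0 * \<alpha> ^ j * b = - (coeff F 0 * \<alpha> ^ i * b)" by (simp add: F0 i algebra_simps)
    also have "\<dots> \<in> ?V" using 0 b i by (intro int_span.span_neg FB) auto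
    finally show ?case .
  next
    case (Suc k)
    then obtain i where i: "j = Suc i" by (cases j) auto
    have "coeff q (Suc k) * \<alpha> ^ j * b = coeff q k * \<alpha> ^ i * b - coeff F (Suc k) * \<alpha> ^ i * b"
      by (simp add: FS i algebra_simps)
    also have "\<dots> \<in> ?V" using Suc b i by (intro int_span.span_diff FB) auto
    finally show ?case .
  qed
  have "coeff q k \<in> stab (adjoin_powers B \<alpha> n)"
    using lo hi by (intro stab_adjoin_powersI) (meson not_le)
  thus ?thesis
    using B by (intro algebraic_int_stab[of "adjoin_powers B \<alpha> n"] finite_adjoin_powers
        one_in_adjoin_powers) (simp_all add: n_def)
qed

lemma algebraic_int_coeff_linear_quotients:
  fixes p :: "complex poly"
  assumes "finite D" and "\<And>i. algebraic_int (coeff ((\<Prod>x\<in>D. [:-x, 1:]) * p) i)"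
  shows "algebraic_int (coeff p i)"
  using assms
proof (induction D arbitrary: i rule: finite_induct)
  case (insert d D)
  have eq: "(\<Prod>x\<in>insert d D. [:-x, 1:]) * p = [:-d, 1:] * ((\<Prod>x\<in>D. [:-x, 1:]) * p)"
    unfolding prod.insert[OF insert.hyps] by (rule mult.assoc)
  have "algebraic_int (coeff ((\<Prod>x\<in>D. [:-x, 1:]) * p) i)" for i
    by (rule algebraic_int_coeff_linear_quotient[OF insert.prems[unfolded eq]])
  thus ?case using insert.IH by blast
qed simp

text \<open>Dividing out the roots outside \<open>S\<close> keeps the coefficients integral; up to
  sign, the constant coefficient of what remains is the number in question.\<close>

lemma algebraic_int_lead_coeff_times_roots:
  fixes A S :: "complex set"
  assumes "finite A" and "\<And>i. algebraic_int (coeff (smult a (\<Prod>x\<in>A. [:-x, 1:])) i)"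
    and "S \<subseteq> A"
  shows "algebraic_int (a * \<Prod>S)"
proof -
  let ?p = "smult a (\<Prod>x\<in>S. [:-x, 1:])"
  have eq: "smult a (\<Prod>x\<in>A. [:-x, 1:]) = (\<Prod>x\<in>A - S. [:-x, 1:]) * ?p"
    unfolding prod.subset_diff[OF assms(3,1)] by (rule mult_smult_right[symmetric])
  have "algebraic_int (coeff ?p 0)"
    using assms(1) by (intro algebraic_int_coeff_linear_quotients[OF _ assms(2)[unfolded eq]]) simp
  hence "algebraic_int (a * (\<Prod>x\<in>S. - x))"
    by (simp add: poly_0_coeff_0[symmetric] poly_prod)
  moreover have "a * (\<Prod>x\<in>S. - x) = a * \<Prod>S \<or> a * (\<Prod>x\<in>S. - x) = - (a * \<Prod>S)"
    by (simp add: prod_uminus uminus_power_if)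
  ultimately show ?thesis by (metis algebraic_int_minus_iff)
qed

section \<open>Automorphisms of the algebraic numbers\<close>

text \<open>A relation satisfying the following axioms is the graph of an isomorphism between two
  subrings of \<open>\<complex>\<close>.\<close>

locale ring_graph =
  fixes R :: "(complex \<times> complex) set"
  assumes one: "(1, 1) \<in> R"
    and plus: "(x, y) \<in> R \<Longrightarrow> (x', y') \<in> R \<Longrightarrow> (x + x', y + y') \<in> R"
    and times: "(x, y) \<in> R \<Longrightarrow> (x', y') \<in> R \<Longrightarrow> (x * x', y * y') \<in> R"
    and uminus: "(x, y) \<in> R \<Longrightarrow> (- x, - y) \<in> R"
    and zero_iff: "(x, y) \<in> R \<Longrightarrow> x = 0 \<longleftrightarrow> y = 0"
begin

definition pol :: "(complex poly \<times> complex poly) set" where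
  "pol = {(A, B). \<forall>i. (coeff A i, coeff B i) \<in> R}"

lemma polD: "(A, B) \<in> pol \<Longrightarrow> (coeff A i, coeff B i) \<in> R"
  by (simp add: pol_def)

lemma zero: "(0, 0) \<in> R"
  using plus[OF one uminus[OF one]] by simp

lemma diff: "(x, y) \<in> R \<Longrightarrow> (x', y') \<in> R \<Longrightarrow> (x - x', y - y') \<in> R"
  using plus[of x y "- x'" "- y'"] uminus by simp

text \<open>Read forwards, the graph is single-valued; read backwards, it is injective.\<close>

lemma eq_iff:
  assumes "(x, y) \<in> R" and "(x', y') \<in> R"
  shows "x = x' \<longleftrightarrow> y = y'"
  using zero_iff[OF diff[OF assms]] by simp

lemma sum: "(\<And>i. i \<in> I \<Longrightarrow> (f i, g i) \<in> R) \<Longrightarrow> (sum f I, sum g I) \<in> R"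
  by (induction I rule: infinite_finite_induct) (auto intro: zero plus)

lemma prod: "(\<And>i. i \<in> I \<Longrightarrow> (f i, g i) \<in> R) \<Longrightarrow> (prod f I, prod g I) \<in> R"
  by (induction I rule: infinite_finite_induct) (auto intro: one times)

lemma power: "(x, y) \<in> R \<Longrightarrow> (x ^ n, y ^ n) \<in> R"
  by (induction n) (auto intro: one times)

lemma of_nat: "(of_nat n, of_nat n) \<in> R"
  by (induction n) (auto intro: zero one plus)

lemma of_int: "(of_int n, of_int n) \<in> R"
  using of_nat uminus[OF of_nat] by (cases n rule: int_cases2) auto

lemma pol_const: "(x, y) \<in> R \<Longrightarrow> ([:x:], [:y:]) \<in> pol"
  by (auto simp: pol_def coeff_pCons zero split: nat.splits)

lemma pol_monom: "(x, y) \<in> R \<Longrightarrow> (monom x n, monom y n) \<in> pol"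
  by (auto simp: pol_def zero)

lemma pol_plus: "(A, B) \<in> pol \<Longrightarrow> (A', B') \<in> pol \<Longrightarrow> (A + A', B + B') \<in> pol"
  by (auto simp: pol_def plus)

lemma pol_uminus: "(A, B) \<in> pol \<Longrightarrow> (- A, - B) \<in> pol"
  by (auto simp: pol_def uminus)

lemma pol_diff: "(A, B) \<in> pol \<Longrightarrow> (A', B') \<in> pol \<Longrightarrow> (A - A', B - B') \<in> pol"
  by (auto simp: pol_def diff)

lemma pol_times: "(A, B) \<in> pol \<Longrightarrow> (A', B') \<in> pol \<Longrightarrow> (A * A', B * B') \<in> pol"
  by (auto simp: pol_def coeff_mult intro!: sum times)

lemma pol_prod: "(\<And>i. i \<in> I \<Longrightarrow> (f i, g i) \<in> pol) \<Longrightarrow> (prod f I, prod g I) \<in> pol"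
  by (induction I rule: infinite_finite_induct)
    (auto intro: pol_times pol_const[OF one, unfolded one_pCons[symmetric]])

lemma pol_of_int: "(map_poly of_int p, map_poly of_int p) \<in> pol"
  by (auto simp: pol_def coeff_map_poly of_int)

lemma pol_zero_iff: "(A, B) \<in> pol \<Longrightarrow> A = 0 \<longleftrightarrow> B = 0"
  using zero_iff by (auto simp: pol_def poly_eq_iff)

lemma pol_degree:
  assumes "(A, B) \<in> pol"
  shows "degree A = degree B"
  using zero_iff[OF polD[OF assms]] by (simp add: degree_def)

lemma pol_poly:
  assumes "(A, B) \<in> pol" and "(x, y) \<in> R"
  shows "(poly A x, poly B y) \<in> R"
  unfolding poly_altdef pol_degree[OF assms(1)]
  by (intro sum times polD power assms)

lemma int_root_iff:
  assumes "(x, y) \<in> R"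
  shows "poly (map_poly of_int p) x = 0 \<longleftrightarrow> poly (map_poly of_int p) y = 0"
  by (rule zero_iff[OF pol_poly[OF pol_of_int assms]])

text \<open>Long division by the monic \<open>P\<close>, carried out on both sides at once, so that
  quotients and remainders correspond as well.\<close>

lemma pol_division:
  assumes PQ: "(P, Q) \<in> pol" and monic: "lead_coeff P = 1" and deg: "degree P > 0"
    and "(A, B) \<in> pol"
  shows "\<exists>S S' T T'. (S, S') \<in> pol \<and> (T, T') \<in> pol \<and> A = P * S + T \<and> B = Q * S' + T' \<and>
    degree T < degree P"
  using assms(4)
proof (induction "degree A" arbitrary: A B rule: less_induct)
  case less
  show ?case
  proof (cases "degree A < degree P")
    case True
    thus ?thesis
      using less.prems pol_const[OF zero]
      by (intro exI[of _ 0] exI[of _ A] exI[of _ B]) auto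
  next
    case False
    define k where "k = degree A - degree P"
    define U where "U = monom (lead_coeff A) k"
    \<comment> \<open>The coefficient of \<open>B\<close> at \<open>degree A\<close> corresponds to
      the leading coefficient of \<open>A\<close> directly by \<open>polD\<close>.\<close>
    define U' where "U' = monom (coeff B (degree A)) k"
    have U: "(U, U') \<in> pol" unfolding U_def U'_def by (intro pol_monom polD less.prems)
    have AB: "(A - P * U, B - Q * U') \<in> pol" by (intro pol_diff pol_times PQ U less.prems)
    have dA: "degree A = degree P + k" using False by (simp add: k_def)
    have "degree (A - P * U) \<le> degree A"
      using dA degree_mult_le[of P U] degree_monom_le[of "lead_coeff A" k]
      by (intro degree_diff_le) (auto simp: U_def)
    moreover have "coeff (A - P * U) (degree A) = 0"
      using monic by (simp add: U_def dA coeff_monom_mult mult.commute[of P])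
    \<comment> \<open>If the difference vanishes, its degree is 0 by convention; this is a drop
      because \<open>P\<close>, and so \<open>A\<close>, has positive degree.\<close>
    ultimately have "degree (A - P * U) < degree A"
      using deg dA by (metis add_gr_0 leading_coeff_0_iff degree_0 order.not_eq_order_implies_strict)
    from less.hyps[OF this AB] obtain S S' T T' where
      ST: "(S, S') \<in> pol" "(T, T') \<in> pol" "A - P * U = P * S + T" "B - Q * U' = Q * S' + T'"
        "degree T < degree P" by blast
    have "A = P * (S + U) + T" "B = Q * (S' + U') + T'"
      using ST(3,4) by (simp_all add: algebra_simps)
    thus ?thesis using ST U pol_plus by blast
  qed
qed

end

lemma ring_graph_converse: "ring_graph R \<Longrightarrow> ring_graph (R\<inverse>)"
  by (auto simp: ring_graph_def)

lemma pol_converse: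
  assumes "ring_graph R"
  shows "(A, B) \<in> ring_graph.pol (R\<inverse>) \<longleftrightarrow> (B, A) \<in> ring_graph.pol R"
  by (simp add: ring_graph.pol_def[OF assms] ring_graph.pol_def[OF ring_graph_converse[OF assms]])

lemma ring_graph_relcomp:
  assumes "ring_graph R" and "ring_graph S"
  shows "ring_graph (R O S)"
proof -
  interpret R: ring_graph R by fact
  interpret S: ring_graph S by fact
  show ?thesis
  proof
    show "(1, 1) \<in> R O S" using R.one S.one by blast
    show "(x + x', y + y') \<in> R O S" if "(x, y) \<in> R O S" "(x', y') \<in> R O S" for x y x' y'
      using that R.plus S.plus by (meson relcomp.simps)
    show "(x * x', y * y') \<in> R O S" if "(x, y) \<in> R O S" "(x', y') \<in> R O S" for x y x' y'
      using that R.times S.times by (meson relcomp.simps)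
    show "(- x, - y) \<in> R O S" if "(x, y) \<in> R O S" for x y
      using that R.uminus S.uminus by (meson relcomp.simps)
    show "x = 0 \<longleftrightarrow> y = 0" if "(x, y) \<in> R O S" for x y
      using that R.zero_iff S.zero_iff by blast
  qed
qed

lemma ring_graph_Id: "ring_graph Id"
  by unfold_locales auto

section \<open>Extension of isomorphisms to all algebraic numbers\<close>

locale max_ring_graph = ring_graph +
  assumes maximal: "ring_graph S \<Longrightarrow> R \<subseteq> S \<Longrightarrow> S = R"
begin

text \<open>The induced isomorphism of fraction fields is a ring graph containing \<open>R\<close>,
  so by maximality it is \<open>R\<close> itself. The default \<open>inverse 0 = 0\<close> is
  harmless by \<open>zero_iff\<close>.\<close>

lemma inverse:
  assumes xy: "(x, y) \<in> R"
  shows "(inverse x, inverse y) \<in> R"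
proof (cases "x = 0")
  case True
  thus ?thesis using xy zero_iff[OF xy] by simp
next
  case False
  define S where "S = {(u / z, v / w) | u v z w. (u, v) \<in> R \<and> (z, w) \<in> R \<and> z \<noteq> 0}"
  have SI: "(u / z, v / w) \<in> S" if "(u, v) \<in> R" "(z, w) \<in> R" "z \<noteq> 0" for u v z w
    using that by (auto simp: S_def)
  have "ring_graph S"
  proof
    show "(1, 1) \<in> S" using SI[OF one one] by simp
    fix a b assume "(a, b) \<in> S"
    then obtain u v z w where ab: "a = u / z" "b = v / w" "(u, v) \<in> R" "(z, w) \<in> R" "z \<noteq> 0"
      unfolding S_def by blast
    hence w: "w \<noteq> 0" using zero_iff by blast
    show "(- a, - b) \<in> S" using SI[OF uminus[OF ab(3)] ab(4,5)] by (simp add: ab)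
    show "a = 0 \<longleftrightarrow> b = 0" using w ab zero_iff[OF ab(3)] by auto
    fix a' b' assume "(a', b') \<in> S"
    then obtain u' v' z' w' where
      ab': "a' = u' / z'" "b' = v' / w'" "(u', v') \<in> R" "(z', w') \<in> R" "z' \<noteq> 0"
      unfolding S_def by blast
    hence w': "w' \<noteq> 0" using zero_iff by blast
    have "((u * u') / (z * z'), (v * v') / (w * w')) \<in> S"
      using ab ab' by (intro SI times) auto
    thus "(a * a', b * b') \<in> S" by (simp add: ab ab')
    have "((u * z' + u' * z) / (z * z'), (v * w' + v' * w) / (w * w')) \<in> S"
      using ab ab' by (intro SI times plus) auto
    thus "(a + a', b + b') \<in> S"
      using w w' ab ab' by (simp add: add_frac_eq)
  qed
  moreover have "R \<subseteq> S" using SI[OF _ one] by auto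
  ultimately have "S = R" by (rule maximal)
  thus ?thesis using SI[OF one xy False] by (simp add: divide_inverse)
qed

text \<open>\<open>P\<close> is the minimal polynomial of \<beta> over the domain of
  \<open>R\<close>, and \<open>Q\<close> is its image. A remainder on division by \<open>P\<close>
  vanishes at \<beta> and has smaller degree, so it is 0, and so is its image.\<close>

lemma minimal_pair:
  assumes "(A, B) \<in> pol" and "A \<noteq> 0" and "poly A \<beta> = 0"
  obtains P Q where "(P, Q) \<in> pol" "P \<noteq> 0" "degree P > 0" "poly P \<beta> = 0"
    "\<And>A B. (A, B) \<in> pol \<Longrightarrow> poly A \<beta> = 0 \<Longrightarrow>
       \<exists>S S'. (S, S') \<in> pol \<and> A = P * S \<and> B = Q * S'"
proof -
  define good where "good = (\<lambda>(A, B). (A, B) \<in> pol \<and> A \<noteq> 0 \<and> poly A \<beta> = 0)"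
  have "good (A, B)" using assms by (simp add: good_def)
  then obtain P0 Q0 where 0: "good (P0, Q0)"
    and min: "\<And>A B. good (A, B) \<Longrightarrow> degree P0 \<le> degree A"
    using ex_has_least_nat[of good "(A, B)" "\<lambda>(A, B). degree A"] by auto
  have PQ0: "(P0, Q0) \<in> pol" "P0 \<noteq> 0" "poly P0 \<beta> = 0" using 0 by (auto simp: good_def)
  define P where "P = [:inverse (lead_coeff P0):] * P0"
  define Q where "Q = [:inverse (coeff Q0 (degree P0)):] * Q0"
  have PQ: "(P, Q) \<in> pol"
    unfolding P_def Q_def by (intro pol_times pol_const inverse polD PQ0)
  have deg: "degree P = degree P0" "lead_coeff P = 1" "P \<noteq> 0" "poly P \<beta> = 0"
    using PQ0 by (auto simp: P_def)
  have "degree P > 0"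
  proof (rule ccontr)
    assume "\<not> degree P > 0"
    then obtain c where "P = [:c:]" by (auto elim: degree_eq_zeroE)
    thus False using deg by simp
  qed
  show thesis
  proof (rule that[OF PQ])
    fix A B assume AB: "(A, B) \<in> pol" "poly A \<beta> = 0"
    obtain S S' T T' where ST: "(S, S') \<in> pol" "(T, T') \<in> pol" "A = P * S + T" "B = Q * S' + T'"
        "degree T < degree P"
      using pol_division[OF PQ deg(2) \<open>degree P > 0\<close> AB(1)] by blast
    have "poly T \<beta> = 0" using AB(2) deg by (simp add: ST(3))
    hence "T = 0" using min[of T T'] ST deg by (force simp: good_def)
    moreover have "T' = 0" using pol_zero_iff[OF ST(2)] \<open>T = 0\<close> by simp
    ultimately show "\<exists>S S'. (S, S') \<in> pol \<and> A = P * S \<and> B = Q * S'" using ST by auto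
  qed (use deg \<open>degree P > 0\<close> in auto)
qed

end

lemma max_ring_graph_converse:
  assumes "max_ring_graph R"
  shows "max_ring_graph (R\<inverse>)"
proof -
  interpret max_ring_graph R by fact
  interpret conv: ring_graph "R\<inverse>" by (rule ring_graph_converse) unfold_locales
  show ?thesis
  proof
    fix S assume "ring_graph S" "R\<inverse> \<subseteq> S"
    hence "S\<inverse> = R" by (intro maximal ring_graph_converse) auto
    thus "S = R\<inverse>" by auto
  qed
qed

text \<open>With \<open>P\<close> minimal for \<beta> and \<gamma> a root of its image
  \<open>Q\<close>, evaluating corresponding polynomials at \<beta> and \<gamma> extends
  \<open>R\<close> to a ring graph that sends \<beta> to \<gamma>. Maximality forces this extension
  to be \<open>R\<close>.\<close>

lemma (in max_ring_graph) domain_algebraic: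
  assumes "algebraic \<beta>"
  shows "\<beta> \<in> Domain R"
proof -
  interpret conv: max_ring_graph "R\<inverse>" by (rule max_ring_graph_converse) unfold_locales
  have conv_pol: "(A, B) \<in> conv.pol \<longleftrightarrow> (B, A) \<in> pol" for A B
    by (rule pol_converse) unfold_locales
  obtain p where "is_min_int_poly \<beta> p" using ex1_min_int_poly[OF assms] by blast
  hence p: "map_poly complex_of_int p \<noteq> 0" "poly (map_poly of_int p) \<beta> = 0"
    by (auto simp: is_min_int_poly_def map_poly_eq_0_iff)
  obtain P Q where PQ: "(P, Q) \<in> pol" "P \<noteq> 0" "degree P > 0" "poly P \<beta> = 0"
    and dvd: "\<And>A B. (A, B) \<in> pol \<Longrightarrow> poly A \<beta> = 0 \<Longrightarrow>
       \<exists>S S'. (S, S') \<in> pol \<and> A = P * S \<and> B = Q * S'"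
    using minimal_pair[OF pol_of_int p] by blast
  have "degree Q > 0" using pol_degree PQ by metis
  then obtain \<gamma> where \<gamma>: "poly Q \<gamma> = 0"
    using Fundamental_Theorem_Algebra.fundamental_theorem_of_algebra[of Q] by (auto simp: constant_degree)
  have "(Q, P) \<in> conv.pol" "Q \<noteq> 0" using PQ conv_pol \<open>degree Q > 0\<close> by auto
  then obtain Q1 P1 where PQ1: "(Q1, P1) \<in> conv.pol" "Q1 \<noteq> 0" "degree Q1 > 0" "poly Q1 \<gamma> = 0"
    and dvd1: "\<And>B A. (B, A) \<in> conv.pol \<Longrightarrow> poly B \<gamma> = 0 \<Longrightarrow>
       \<exists>S' S. (S', S) \<in> conv.pol \<and> B = Q1 * S' \<and> A = P1 * S"
    using conv.minimal_pair[of Q P \<gamma>] \<gamma> by metis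
  \<comment> \<open>This gives injectivity of the extension. Here \<open>P = P1 * S\<close>; if
    \<open>P1\<close> did not vanish at \<beta>, then \<open>S\<close> would, so \<open>P\<close>
    would divide \<open>S\<close> and \<open>P1\<close> would be a unit, against its positive
    degree.\<close>
  have P1: "poly P1 \<beta> = 0"
  proof (rule ccontr)
    assume nz: "poly P1 \<beta> \<noteq> 0"
    obtain S' S where S: "(S', S) \<in> conv.pol" "P = P1 * S"
      using dvd1[of Q P] PQ \<gamma> conv_pol by blast
    have "poly S \<beta> = 0" using PQ(4) nz by (simp add: S(2))
    then obtain U where "S = P * U" using dvd S conv_pol by blast
    hence "P = P * (P1 * U)" using S(2) by (simp add: mult_ac)
    hence "P1 * U = 1" using PQ(2) by (metis mult.right_neutral mult_left_cancel)
    hence "P1 dvd 1" by (metis dvd_triv_left)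
    hence "degree P1 = 0" by (simp add: poly_dvd_1)
    thus False using PQ1 conv.pol_degree by fastforce
  qed
  define S where "S = {(poly A \<beta>, poly B \<gamma>) | A B. (A, B) \<in> pol}"
  have SI: "(poly A \<beta>, poly B \<gamma>) \<in> S" if "(A, B) \<in> pol" for A B
    using that by (auto simp: S_def)
  have "ring_graph S"
  proof
    show "(1, 1) \<in> S" using SI[OF pol_const[OF one]] by simp
    fix a b assume "(a, b) \<in> S"
    then obtain A B where AB: "(A, B) \<in> pol" "a = poly A \<beta>" "b = poly B \<gamma>"
      unfolding S_def by blast
    show "(- a, - b) \<in> S" using SI[OF pol_uminus[OF AB(1)]] by (simp add: AB)
    show "a = 0 \<longleftrightarrow> b = 0"
    proof
      assume "a = 0"
      thus "b = 0" using dvd[of A B] AB \<gamma> by auto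
    next
      assume "b = 0"
      thus "a = 0" using dvd1[of B A] AB P1 conv_pol by auto
    qed
    fix a' b' assume "(a', b') \<in> S"
    then obtain A' B' where AB': "(A', B') \<in> pol" "a' = poly A' \<beta>" "b' = poly B' \<gamma>"
      unfolding S_def by blast
    show "(a + a', b + b') \<in> S" using SI[OF pol_plus[OF AB(1) AB'(1)]] by (simp add: AB AB')
    show "(a * a', b * b') \<in> S" using SI[OF pol_times[OF AB(1) AB'(1)]] by (simp add: AB AB')
  qed
  moreover have "R \<subseteq> S" using SI[OF pol_const] by auto
  ultimately have "S = R" by (rule maximal)
  thus ?thesis using SI[OF pol_monom[OF one, of 1]] by (auto simp: poly_monom)
qed

text \<open>Zorn's lemma: two pairs in the union of a chain already lie in one member, so the union
  is again a ring graph.\<close>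

lemma ring_graph_extend_maximal:
  assumes "ring_graph R"
  obtains M where "max_ring_graph M" and "R \<subseteq> M"
proof -
  define \<A> where "\<A> = {S. ring_graph S \<and> R \<subseteq> S}"
  have "\<Union>\<C> \<in> \<A>" if "\<C> \<noteq> {}" "subset.chain \<A> \<C>" for \<C>
  proof -
    have ring: "ring_graph S" "R \<subseteq> S" if "S \<in> \<C>" for S
      using that \<open>subset.chain \<A> \<C>\<close> by (auto simp: subset.chain_def \<A>_def)
    have pair: "\<exists>S\<in>\<C>. p \<in> S \<and> q \<in> S" if pq: "p \<in> \<Union>\<C>" "q \<in> \<Union>\<C>" for p q
    proof -
      obtain S T where ST: "S \<in> \<C>" "p \<in> S" "T \<in> \<C>" "q \<in> T" using pq by blast
      hence "S \<subseteq> T \<or> T \<subseteq> S"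
        using \<open>subset.chain \<A> \<C>\<close> unfolding subset_chain_def by blast
      thus ?thesis using ST by blast
    qed
    have "ring_graph (\<Union>\<C>)"
    proof
      show "(1, 1) \<in> \<Union>\<C>" using \<open>\<C> \<noteq> {}\<close> ring(1) ring_graph.one by blast
      fix x y assume xy: "(x, y) \<in> \<Union>\<C>"
      then obtain S where S: "S \<in> \<C>" "(x, y) \<in> S" by blast
      show "(- x, - y) \<in> \<Union>\<C>" using ring_graph.uminus[OF ring(1)] S by blast
      show "x = 0 \<longleftrightarrow> y = 0" using ring_graph.zero_iff[OF ring(1)] S by blast
      fix x' y' assume "(x', y') \<in> \<Union>\<C>"
      then obtain S where S: "S \<in> \<C>" "(x, y) \<in> S" "(x', y') \<in> S" using pair xy by blast
      show "(x + x', y + y') \<in> \<Union>\<C>" using ring_graph.plus[OF ring(1)] S by blast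
      show "(x * x', y * y') \<in> \<Union>\<C>" using ring_graph.times[OF ring(1)] S by blast
    qed
    thus ?thesis using ring(2) \<open>\<C> \<noteq> {}\<close> by (auto simp: \<A>_def)
  qed
  moreover have "\<A> \<noteq> {}" using assms by (auto simp: \<A>_def)
  ultimately obtain M where M: "M \<in> \<A>" "\<And>S. S \<in> \<A> \<Longrightarrow> M \<subseteq> S \<Longrightarrow> S = M"
    using subset_Zorn_nonempty[of \<A>] by blast
  have "max_ring_graph M"
    unfolding max_ring_graph_def max_ring_graph_axioms_def
    using M by (auto simp: \<A>_def)
  thus thesis using that M(1) by (simp add: \<A>_def)
qed

text \<open>The elements restrict to the automorphisms of the field of algebraic numbers; their values at
  transcendental numbers play no role.\<close>

definition Gal :: "(complex \<times> complex) set set" where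
  "Gal = {R. ring_graph R \<and> Collect algebraic \<subseteq> Domain R \<and> Collect algebraic \<subseteq> Range R}"

lemma Gal_ring_graph: "R \<in> Gal \<Longrightarrow> ring_graph R"
  by (simp add: Gal_def)

lemma Gal_obtain_image:
  assumes "R \<in> Gal" and "algebraic x"
  obtains y where "(x, y) \<in> R"
  using assms by (auto simp: Gal_def Domain_iff subset_iff)

lemma Gal_Id: "Id \<in> Gal"
  by (auto simp: Gal_def ring_graph_Id)

lemma Gal_converse: "R \<in> Gal \<Longrightarrow> R\<inverse> \<in> Gal"
  by (auto simp: Gal_def ring_graph_converse)

section \<open>Conjugates and the Galois action on them\<close>

definition conjs :: "complex \<Rightarrow> complex set" where
  "conjs x = {y. poly (map_poly of_int (min_int_poly x)) y = 0}"

lemma min_int_poly: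
  assumes "algebraic x"
  shows "is_min_int_poly x (min_int_poly x)"
  unfolding min_int_poly_def by (rule theI'[OF ex1_min_int_poly[OF assms]])

lemma min_int_polyD:
  assumes "algebraic x"
  shows "irreducible (min_int_poly x)" "lead_coeff (min_int_poly x) > 0"
    "poly (map_poly of_int (min_int_poly x)) x = 0" "min_int_poly x \<noteq> 0"
  using min_int_poly[OF assms] by (auto simp: is_min_int_poly_def)

lemma finite_conjs: "algebraic x \<Longrightarrow> finite (conjs x)"
  using min_int_polyD(4) by (auto simp: conjs_def poly_roots_finite map_poly_eq_0_iff)

lemma self_in_conjs: "algebraic x \<Longrightarrow> x \<in> conjs x"
  by (simp add: conjs_def min_int_polyD)

lemma algebraic_of_int_poly:
  assumes "p \<noteq> 0" and "poly (map_poly of_int p) (x :: complex) = 0"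
  shows "algebraic x"
  using assms by (intro algebraicI[of "map_poly of_int p"]) (auto simp: coeff_map_poly map_poly_eq_0_iff)

lemma conjs_algebraic: "algebraic x \<Longrightarrow> y \<in> conjs x \<Longrightarrow> algebraic y"
  using algebraic_of_int_poly min_int_polyD(4) by (auto simp: conjs_def)

lemma conjs_eq:
  assumes "algebraic x" and "y \<in> conjs x"
  shows "min_int_poly y = min_int_poly x" and "conjs y = conjs x"
proof -
  have y: "algebraic y" using assms by (rule conjs_algebraic)
  have "is_min_int_poly y (min_int_poly x)"
    using min_int_polyD[OF assms(1)] assms(2) by (auto simp: is_min_int_poly_def conjs_def)
  thus "min_int_poly y = min_int_poly x"
    using ex1_min_int_poly[OF y] min_int_poly[OF y] by blast
  thus "conjs y = conjs x" by (simp add: conjs_def)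
qed

lemma Gal_conjs:
  assumes "R \<in> Gal" and "algebraic x" and "(x, y) \<in> R"
  shows "y \<in> conjs x"
  using ring_graph.int_root_iff[OF Gal_ring_graph[OF assms(1)] assms(3)] min_int_polyD(3)[OF assms(2)]
  by (simp add: conjs_def)

lemma Gal_algebraic: "R \<in> Gal \<Longrightarrow> algebraic x \<Longrightarrow> (x, y) \<in> R \<Longrightarrow> algebraic y"
  using Gal_conjs conjs_algebraic by blast

lemma Gal_relcomp:
  assumes "R \<in> Gal" and "S \<in> Gal"
  shows "R O S \<in> Gal"
proof -
  have "x \<in> Domain (R' O S')" if "R' \<in> Gal" "S' \<in> Gal" "algebraic x" for R' S' x
    by (meson Domain.DomainI Gal_algebraic Gal_obtain_image relcomp.relcompI that)
  from this[of R S] this[of "S\<inverse>" "R\<inverse>"] show ?thesis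
    using assms Gal_converse by (auto simp: Gal_def ring_graph_relcomp simp flip: converse_relcomp)
qed

text \<open>Sending p(x) to p(y) for integer polynomials p is well defined and injective, as both
  values vanish exactly when the common minimal polynomial divides p. A maximal extension then has
  all algebraic numbers in its domain and range.\<close>

lemma ex_Gal_conj:
  assumes "algebraic x" and "y \<in> conjs x"
  shows "\<exists>R\<in>Gal. (x, y) \<in> R"
proof -
  define R where "R = {(poly (map_poly of_int p) x, poly (map_poly of_int p) y) | p. True}"
  have RI: "(poly (map_poly of_int p) x, poly (map_poly of_int p) y) \<in> R" for p
    by (auto simp: R_def)
  note mp = min_int_polyD[OF assms(1)]
  have "ring_graph R"
  proof
    show "(1, 1) \<in> R" using RI[of 1] by simp
    fix a b assume "(a, b) \<in> R"
    then obtain p where p: "a = poly (map_poly of_int p) x" "b = poly (map_poly of_int p) y"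
      by (auto simp: R_def)
    show "(- a, - b) \<in> R" using RI[of "- p"] map_poly_of_int_smult[of "-1" p] by (simp add: p)
    show "a = 0 \<longleftrightarrow> b = 0"
    proof
      assume "a = 0"
      hence "min_int_poly x dvd p" using mp p by (intro irreducible_root_dvd) auto
      thus "b = 0" using assms(2) by (auto simp: p conjs_def map_poly_of_int_mult)
    next
      assume "b = 0"
      hence "min_int_poly x dvd p" using mp p assms(2)
        by (intro irreducible_root_dvd[of _ y]) (auto simp: conjs_def)
      thus "a = 0" using mp by (auto simp: p map_poly_of_int_mult)
    qed
    fix a' b' assume "(a', b') \<in> R"
    then obtain q where q: "a' = poly (map_poly of_int q) x" "b' = poly (map_poly of_int q) y"
      by (auto simp: R_def)
    show "(a + a', b + b') \<in> R" using RI[of "p + q"] by (simp add: p q map_poly_of_int_add)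
    show "(a * a', b * b') \<in> R" using RI[of "p * q"] by (simp add: p q map_poly_of_int_mult)
  qed
  then obtain M where M: "max_ring_graph M" "R \<subseteq> M" by (rule ring_graph_extend_maximal)
  have "(x, y) \<in> M" using RI[of "[:0, 1:]"] M(2) by (auto simp: map_poly_pCons)
  moreover have "M \<in> Gal"
    using max_ring_graph.domain_algebraic[OF M(1)]
      max_ring_graph.domain_algebraic[OF max_ring_graph_converse[OF M(1)]] M(1)
    by (auto simp: Gal_def max_ring_graph_def)
  ultimately show ?thesis by blast
qed

text \<open>A multiple root would be a root of the derivative as well, so the irreducible polynomial
  would divide its own derivative.\<close>

lemma rsquarefree_min_int_poly:
  assumes "algebraic x"
  shows "rsquarefree (map_poly complex_of_int (min_int_poly x))"
  unfolding rsquarefree_roots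
proof (intro allI notI, elim conjE)
  let ?p = "min_int_poly x"
  fix y assume y: "poly (map_poly complex_of_int ?p) y = 0"
    "poly (pderiv (map_poly complex_of_int ?p)) y = 0"
  have "pderiv (map_poly complex_of_int ?p) = map_poly of_int (pderiv ?p)"
    by (intro poly_eqI) (simp add: coeff_map_poly coeff_pderiv)
  hence "?p dvd pderiv ?p"
    using y min_int_polyD[OF assms] by (intro irreducible_root_dvd[of _ y]) auto
  moreover have "degree ?p > 0"
  proof (rule ccontr)
    assume "\<not> degree ?p > 0"
    then obtain c where "?p = [:c:]" by (auto elim: degree_eq_zeroE)
    thus False using y(1) min_int_polyD(4)[OF assms] by (auto simp: map_poly_pCons)
  qed
  ultimately show False using not_dvd_pderiv by blast
qed

lemma min_int_poly_conv_prod: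
  assumes "algebraic x"
  shows "map_poly of_int (min_int_poly x) =
    smult (of_int (lead_coeff (min_int_poly x))) (\<Prod>y\<in>conjs x. [:-y, 1:])"
  using complex_poly_decompose_rsquarefree[OF rsquarefree_min_int_poly[OF assms]]
  by (simp add: conjs_def)

lemma degree_min_int_poly:
  assumes "algebraic x"
  shows "degree (min_int_poly x) = card (conjs x)"
proof -
  have "degree (map_poly complex_of_int (min_int_poly x)) = card (conjs x)"
    using min_int_polyD(4)[OF assms] unfolding min_int_poly_conv_prod[OF assms]
    by (simp add: degree_prod_eq_sum_degree)
  thus ?thesis by simp
qed

text \<open>Every conjugate of \<open>x\<close> is the image of \<open>x\<close> under some
  automorphism, so \<open>x\<close> is its only conjugate and its minimal polynomial is
  linear.\<close>

lemma Gal_fixed_rational: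
  assumes "algebraic x" and "\<And>R. R \<in> Gal \<Longrightarrow> (x, x) \<in> R"
  shows "x \<in> \<rat>"
proof -
  have "y = x" if y: "y \<in> conjs x" for y
  proof -
    obtain R where R: "R \<in> Gal" "(x, y) \<in> R" using ex_Gal_conj[OF assms(1) y] by blast
    show ?thesis using ring_graph.eq_iff[OF Gal_ring_graph[OF R(1)] R(2) assms(2)[OF R(1)]] by simp
  qed
  hence "conjs x = {x}" using self_in_conjs[OF assms(1)] by blast
  hence eq: "map_poly of_int (min_int_poly x) = smult (of_int (lead_coeff (min_int_poly x))) [:-x, 1:]"
    using min_int_poly_conv_prod[OF assms(1)] by simp
  let ?a = "lead_coeff (min_int_poly x)" and ?b = "coeff (min_int_poly x) 0"
  have "complex_of_int ?b = - (of_int ?a * x)" using arg_cong[OF eq, of "\<lambda>p. coeff p 0"] by simp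
  hence "x = - of_int ?b / of_int ?a" using min_int_polyD(4)[OF assms(1)] by (simp add: field_simps)
  thus ?thesis by (metis Rats_divide Rats_minus_iff Rats_of_int)
qed

section \<open>Mahler measures of polynomials\<close>

lemma log_plus_nonneg: "log_plus x \<ge> 0"
  by (simp add: log_plus_def)

lemma log_plus_mult_le:
  assumes "x \<ge> 0" and "y \<ge> 0"
  shows "log_plus (x * y) \<le> log_plus x + log_plus y"
  using assms by (cases "x = 0 \<or> y = 0") (auto simp: log_plus_def ln_mult)

lemma log_plus_prod_le: "log_plus (cmod (\<Prod>B)) \<le> (\<Sum>x\<in>B. log_plus (cmod x))"
proof (induction B rule: infinite_finite_induct)
  case (insert x B)
  thus ?case using log_plus_mult_le[of "cmod x" "cmod (\<Prod>B)"] by (simp add: norm_mult)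
qed (auto simp: log_plus_def)

lemma log_plus_power:
  assumes "x \<ge> 0"
  shows "log_plus (x ^ k) = real k * log_plus x"
  using assms by (cases "x = 0") (auto simp: log_plus_def ln_realpow max_mult_distrib_left power_0_left)

text \<open>Unlike \<open>mahler\<close>, this is additive on products, which allows comparing a
  number with any integer polynomial that vanishes at it.\<close>

definition poly_mahler :: "complex poly \<Rightarrow> real" where
  "poly_mahler p = ln (cmod (lead_coeff p)) + (\<Sum>z\<in>#proots p. log_plus (cmod z))"

lemma mahler_conv_poly_mahler: "mahler x = poly_mahler (map_poly of_int (min_int_poly x))"
  by (simp add: mahler_def poly_mahler_def)

lemma poly_mahler_mult:
  assumes "p \<noteq> 0" and "q \<noteq> 0"
  shows "poly_mahler (p * q) = poly_mahler p + poly_mahler q"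
  using assms by (simp add: poly_mahler_def lead_coeff_mult norm_mult ln_mult proots_mult)

lemma poly_mahler_smult:
  assumes "c \<noteq> 0" and "p \<noteq> 0"
  shows "poly_mahler (smult c p) = ln (cmod c) + poly_mahler p"
  using assms by (simp add: poly_mahler_def norm_mult ln_mult)

lemma poly_mahler_prod:
  assumes "\<And>i. i \<in> I \<Longrightarrow> f i \<noteq> 0"
  shows "poly_mahler (prod f I) = (\<Sum>i\<in>I. poly_mahler (f i))"
  using assms
proof (induction I rule: infinite_finite_induct)
  case (insert i I)
  have "prod f I \<noteq> 0" using insert by (simp add: prod_zero_iff)
  thus ?case using insert by (simp add: poly_mahler_mult)
qed (auto simp: poly_mahler_def)

lemma degree_monom_minus_const:
  assumes "k > 0"
  shows "degree (monom (1 :: complex) k - [:c:]) = k"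
proof -
  have "degree (monom (1 :: complex) k + - [:c:]) = degree (monom (1 :: complex) k)"
    using assms by (intro degree_add_eq_left) (simp add: degree_monom_eq)
  thus ?thesis unfolding diff_conv_add_uminus by (simp add: degree_monom_eq)
qed

text \<open>All \<open>k\<close> roots have the same modulus, whose \<open>k\<close>-th power is
  |c|, so each contributes one \<open>k\<close>-th of the total.\<close>

lemma poly_mahler_monom_minus_const:
  assumes "k > 0"
  shows "poly_mahler (monom 1 k - [:c:]) = log_plus (cmod c)"
proof -
  let ?p = "monom 1 k - [:c:] :: complex poly"
  have deg: "degree ?p = k" by (rule degree_monom_minus_const[OF assms])
  hence lead: "lead_coeff ?p = 1" using assms by (simp add: coeff_eq_0)
  hence nz: "?p \<noteq> 0" by (metis leading_coeff_0_iff zero_neq_one)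
  have "log_plus (cmod z) = log_plus (cmod c) / real k" if "z \<in># proots ?p" for z
  proof -
    have "z ^ k = c" using that nz by (simp add: poly_monom)
    hence "cmod c = cmod z ^ k" by (metis norm_power)
    thus ?thesis using assms by (simp add: log_plus_power)
  qed
  hence "(\<Sum>z\<in>#proots ?p. log_plus (cmod z)) = (\<Sum>z\<in>#proots ?p. log_plus (cmod c) / real k)"
    by (intro arg_cong[of _ _ sum_mset] image_mset_cong)
  also have "\<dots> = log_plus (cmod c)" using assms by (simp add: size_proots_complex deg)
  finally show ?thesis using lead by (simp add: poly_mahler_def)
qed

lemma poly_mahler_of_int_nonneg:
  assumes "p \<noteq> 0"
  shows "poly_mahler (map_poly of_int p) \<ge> 0"
proof -
  have "(\<Sum>z\<in>#M. log_plus (cmod z)) \<ge> 0" for M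
    by (induction M) (auto simp: log_plus_nonneg)
  moreover have "\<bar>lead_coeff p\<bar> \<noteq> 0" using assms by simp
  hence "real_of_int \<bar>lead_coeff p\<bar> \<ge> 1" by linarith
  ultimately show ?thesis by (simp add: poly_mahler_def)
qed

lemma mahler_nonneg: "algebraic x \<Longrightarrow> mahler x \<ge> 0"
  unfolding mahler_conv_poly_mahler by (intro poly_mahler_of_int_nonneg min_int_polyD)

text \<open>The minimal polynomial divides \<open>p\<close>, and the cofactor, being an integer
  polynomial, has nonnegative measure.\<close>

lemma mahler_le_poly_mahler:
  assumes "p \<noteq> 0" and "poly (map_poly of_int p) x = 0"
  shows "mahler x \<le> poly_mahler (map_poly of_int p)"
proof -
  have x: "algebraic x" using assms by (rule algebraic_of_int_poly)
  note mp = min_int_polyD[OF x]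
  have "min_int_poly x dvd p" using mp assms by (intro irreducible_root_dvd) auto
  then obtain q where q: "p = min_int_poly x * q" by blast
  hence "q \<noteq> 0" using assms(1) by auto
  thus ?thesis
    using mp(4) poly_mahler_of_int_nonneg[of q]
    by (simp add: q map_poly_of_int_mult poly_mahler_mult map_poly_eq_0_iff mahler_conv_poly_mahler)
qed

lemma mahler_conv_conjs:
  assumes "algebraic x"
  shows "mahler x = ln (of_int (lead_coeff (min_int_poly x))) + (\<Sum>y\<in>conjs x. log_plus (cmod y))"
proof -
  let ?a = "lead_coeff (min_int_poly x)"
  have a: "?a > 0" by (rule min_int_polyD[OF assms])
  have "poly_mahler (\<Prod>y\<in>conjs x. [:-y, 1:]) = (\<Sum>y\<in>conjs x. log_plus (cmod y))"
    by (simp add: poly_mahler_prod) (simp add: poly_mahler_def)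
  moreover have "(\<Prod>y\<in>conjs x. [:-y, 1:]) \<noteq> 0"
    using finite_conjs[OF assms] by (simp add: prod_zero_iff)
  ultimately show ?thesis
    using a unfolding mahler_conv_poly_mahler min_int_poly_conv_prod[OF assms]
    by (subst poly_mahler_smult) auto
qed

section \<open>Northcott finiteness and numbers of Mahler measure zero\<close>

lemma norm_coeff_prod_linear_le:
  fixes A :: "complex set"
  assumes "finite A"
  shows "cmod (coeff (\<Prod>y\<in>A. [:-y, 1:]) i) \<le> (\<Prod>y\<in>A. 1 + cmod y)"
  using assms
proof (induction A arbitrary: i rule: finite_induct)
  case empty
  show ?case by (simp add: coeff_1)
next
  case (insert y A)
  let ?q = "\<Prod>y\<in>A. [:-y, 1:]" and ?c = "\<Prod>y\<in>A. 1 + cmod y"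
  have "coeff (\<Prod>y\<in>insert y A. [:-y, 1:]) i = coeff (pCons 0 ?q) i - y * coeff ?q i"
    using insert.hyps by simp
  also have "cmod \<dots> \<le> cmod (coeff (pCons 0 ?q) i) + cmod (y * coeff ?q i)"
    by (rule norm_triangle_ineq4)
  also have "\<dots> \<le> ?c + cmod y * ?c"
  proof (rule add_mono)
    show "cmod (coeff (pCons 0 ?q) i) \<le> ?c"
      using insert.IH by (auto simp: coeff_pCons prod_nonneg split: nat.splits)
    show "cmod (y * coeff ?q i) \<le> cmod y * ?c"
      using insert.IH by (simp add: norm_mult mult_left_mono)
  qed
  finally have "cmod (coeff (\<Prod>y\<in>insert y A. [:-y, 1:]) i) \<le> ?c + cmod y * ?c" .
  thus ?case using insert.hyps by (simp add: algebra_simps)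
qed

lemma finite_bounded_int_polys:
  "finite {p :: int poly. degree p \<le> D \<and> (\<forall>i. \<bar>coeff p i\<bar> \<le> K)}"
proof (rule finite_subset)
  let ?L = "{xs. set xs \<subseteq> {-K..K} \<and> length xs = Suc D}"
  show "finite (Poly ` ?L)" by (intro finite_imageI finite_lists_length_eq) simp
  show "{p :: int poly. degree p \<le> D \<and> (\<forall>i. \<bar>coeff p i\<bar> \<le> K)} \<subseteq> Poly ` ?L"
  proof
    fix p :: "int poly" assume p: "p \<in> {p. degree p \<le> D \<and> (\<forall>i. \<bar>coeff p i\<bar> \<le> K)}"
    have "p = Poly (map (coeff p) [0..<Suc D])"
      using p by (intro poly_eqI) (auto simp: nth_default_def coeff_eq_0 simp del: upt_Suc)
    moreover have "map (coeff p) [0..<Suc D] \<in> ?L"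
      using p by (auto simp: abs_le_iff minus_le_iff)
    ultimately show "p \<in> Poly ` ?L" by blast
  qed
qed

text \<open>Each factor 1 + |y| is at most 2 max(1, |y|), and the leading coefficient times the
  product of the max(1, |y|) is \<open>exp (mahler x)\<close>.\<close>

lemma min_int_poly_coeff_le:
  assumes "algebraic x"
  shows "\<bar>real_of_int (coeff (min_int_poly x) i)\<bar> \<le> 2 ^ degree (min_int_poly x) * exp (mahler x)"
proof -
  let ?a = "lead_coeff (min_int_poly x)"
  have a: "?a > 0" by (rule min_int_polyD[OF assms])
  have fin: "finite (conjs x)" by (rule finite_conjs[OF assms])
  have le: "1 + cmod y \<le> 2 * exp (log_plus (cmod y))" for y
    by (cases "cmod y \<le> 1"; cases "y = 0") (auto simp: log_plus_def max_def)
  have "\<bar>real_of_int (coeff (min_int_poly x) i)\<bar> = cmod (coeff (map_poly of_int (min_int_poly x)) i)"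
    by (simp add: coeff_map_poly)
  also have "\<dots> = of_int ?a * cmod (coeff (\<Prod>y\<in>conjs x. [:-y, 1:]) i)"
    using a unfolding min_int_poly_conv_prod[OF assms] by (simp add: norm_mult)
  also have "\<dots> \<le> of_int ?a * (\<Prod>y\<in>conjs x. 1 + cmod y)"
    using a by (intro mult_left_mono norm_coeff_prod_linear_le fin) auto
  also have "\<dots> \<le> of_int ?a * (\<Prod>y\<in>conjs x. 2 * exp (log_plus (cmod y)))"
    using a le by (intro mult_left_mono prod_mono) auto
  also have "\<dots> = 2 ^ degree (min_int_poly x) * exp (mahler x)"
    using a fin by (simp add: mahler_conv_conjs[OF assms] exp_add exp_sum prod.distrib degree_min_int_poly assms)
  finally show ?thesis .
qed

text \<open>Northcott: only finitely many integer polynomials satisfy the coefficient bound for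
  degree at most \<open>D\<close> and measure at most 1, so their positive measures cannot
  accumulate at 0.\<close>

lemma mahler_gap_bounded_degree:
  "\<exists>c>0. \<forall>x. algebraic x \<longrightarrow> degree (min_int_poly x) \<le> D \<longrightarrow> mahler x = 0 \<or> mahler x \<ge> c"
proof -
  define K where "K = \<lceil>2 ^ D * exp (1 :: real)\<rceil>"
  define V where "V = (\<lambda>p. poly_mahler (map_poly of_int p)) `
    {p :: int poly. degree p \<le> D \<and> (\<forall>i. \<bar>coeff p i\<bar> \<le> K)}"
  \<comment> \<open>The element 1 makes the set nonempty and takes care of numbers of measure above
    1.\<close>
  define c where "c = Min (insert 1 {v \<in> V. v > 0})"
  have fin: "finite V" unfolding V_def by (intro finite_imageI finite_bounded_int_polys)
  hence "c > 0" unfolding c_def by (subst Min_gr_iff) auto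
  moreover have "mahler x = 0 \<or> mahler x \<ge> c" if x: "algebraic x" "degree (min_int_poly x) \<le> D" for x
  proof (cases "mahler x \<le> 1")
    case True
    have "\<bar>coeff (min_int_poly x) i\<bar> \<le> K" for i
    proof -
      have "\<bar>real_of_int (coeff (min_int_poly x) i)\<bar> \<le> 2 ^ degree (min_int_poly x) * exp (mahler x)"
        by (rule min_int_poly_coeff_le[OF x(1)])
      also have "\<dots> \<le> 2 ^ D * exp 1"
        using True x by (intro mult_mono power_increasing) auto
      also have "\<dots> \<le> of_int K" by (simp add: K_def)
      finally show ?thesis by linarith
    qed
    hence "mahler x \<in> V" using x by (auto simp: V_def mahler_conv_poly_mahler)
    thus ?thesis
      using mahler_nonneg[OF x(1)] fin unfolding c_def
      by (cases "mahler x = 0") (auto intro!: Min_le)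
  next
    case False
    have "c \<le> 1" unfolding c_def using fin by (intro Min_le) auto
    thus ?thesis using False by auto
  qed
  ultimately show ?thesis by blast
qed

lemma lead_coeff_min_int_poly_algebraic_int:
  assumes "algebraic_int x"
  shows "lead_coeff (min_int_poly x) = 1"
proof -
  have x: "algebraic x" using assms by auto
  obtain p where p: "poly (map_poly of_int p) x = 0" "lead_coeff p = 1"
    using assms by (auto simp: algebraic_int_altdef_ipoly)
  note mp = min_int_polyD[OF x]
  have "min_int_poly x dvd p" using mp p by (intro irreducible_root_dvd) auto
  hence "lead_coeff (min_int_poly x) dvd 1" using p(2) by (metis dvd_def lead_coeff_mult)
  thus ?thesis using mp(2) by simp
qed

text \<open>All summands in \<open>mahler_conv_conjs\<close> are nonnegative. In this form the
  vanishing of the measure can be transferred between a number and its powers.\<close>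

lemma mahler_eq_0_iff:
  assumes "algebraic x"
  shows "mahler x = 0 \<longleftrightarrow> algebraic_int x \<and> (\<forall>y\<in>conjs x. cmod y \<le> 1)"
proof
  let ?a = "lead_coeff (min_int_poly x)"
  note mp = min_int_polyD[OF assms]
  have fin: "finite (conjs x)" by (rule finite_conjs[OF assms])
  have ln: "ln (real_of_int ?a) \<ge> 0" using mp(2) by simp
  have sum: "(\<Sum>y\<in>conjs x. log_plus (cmod y)) \<ge> 0" by (intro sum_nonneg log_plus_nonneg)
  {
    assume "mahler x = 0"
    hence 0: "ln (real_of_int ?a) = 0" "(\<Sum>y\<in>conjs x. log_plus (cmod y)) = 0"
      using ln sum mahler_conv_conjs[OF assms] by linarith+
    have "?a = 1" using 0(1) mp(2) by simp
    hence "algebraic_int x" using mp(3) by (auto simp: algebraic_int_altdef_ipoly)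
    moreover have "cmod y \<le> 1" if "y \<in> conjs x" for y
    proof -
      have "log_plus (cmod y) = 0"
        using 0(2) that fin by (subst (asm) sum_nonneg_eq_0_iff) (auto simp: log_plus_nonneg)
      thus ?thesis by (cases "y = 0") (auto simp: log_plus_def max_def split: if_splits)
    qed
    ultimately show "algebraic_int x \<and> (\<forall>y\<in>conjs x. cmod y \<le> 1)" by blast
  }
  assume x: "algebraic_int x \<and> (\<forall>y\<in>conjs x. cmod y \<le> 1)"
  have "log_plus (cmod y) = 0" if "y \<in> conjs x" for y
    using x that by (cases "y = 0") (auto simp: log_plus_def)
  thus "mahler x = 0"
    using x by (simp add: mahler_conv_conjs[OF assms] lead_coeff_min_int_poly_algebraic_int)
qed

section \<open>Norms to the splitting field\<close>

definition app :: "(complex \<times> complex) set \<Rightarrow> complex \<Rightarrow> complex" where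
  "app R x = (THE y. (x, y) \<in> R)"

lemma app_eq:
  assumes "R \<in> Gal" and "(x, y) \<in> R"
  shows "app R x = y"
  unfolding app_def
  using assms(2) ring_graph.eq_iff[OF Gal_ring_graph[OF assms(1)] _ assms(2)]
  by (intro the_equality) auto

lemma app_in:
  assumes "R \<in> Gal" and "algebraic x"
  shows "(x, app R x) \<in> R"
  using Gal_obtain_image[OF assms] app_eq[OF assms(1)] by metis

lemma algebraic_app: "R \<in> Gal \<Longrightarrow> algebraic x \<Longrightarrow> algebraic (app R x)"
  using app_in Gal_algebraic by blast

lemma app_relcomp:
  assumes "R \<in> Gal" and "S \<in> Gal" and "algebraic x"
  shows "app (R O S) x = app S (app R x)"
  using assms by (intro app_eq Gal_relcomp) (auto intro: app_in algebraic_app)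

lemma inj_on_app:
  assumes "R \<in> Gal"
  shows "inj_on (app R) (Collect algebraic)"
  by (rule inj_onI) (use assms app_in ring_graph.eq_iff[OF Gal_ring_graph[OF assms]] in force)

lemma Gal_Image:
  assumes "R \<in> Gal" and "A \<subseteq> Collect algebraic"
  shows "R `` A = app R ` A"
  using assms app_in app_eq by (auto simp: Image_iff image_iff) (metis app_eq subsetD mem_Collect_eq)+

lemma Gal_Image_converse:
  assumes "R \<in> Gal" and "A \<subseteq> Collect algebraic"
  shows "R\<inverse> `` (R `` A) = A"
proof
  show "R\<inverse> `` (R `` A) \<subseteq> A"
    using ring_graph.eq_iff[OF Gal_ring_graph[OF assms(1)]] by auto
  show "A \<subseteq> R\<inverse> `` (R `` A)"
    using app_in[OF assms(1)] assms(2) by blast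
qed

lemma Gal_prod_Image:
  assumes "R \<in> Gal" and "A \<subseteq> Collect algebraic"
  shows "(\<Prod>A, \<Prod>(R `` A)) \<in> R"
proof -
  have "\<Prod>(R `` A) = (\<Prod>x\<in>A. app R x)"
    unfolding Gal_Image[OF assms]
    using inj_on_subset[OF inj_on_app[OF assms(1)] assms(2)] by (simp add: prod.reindex)
  thus ?thesis
    using ring_graph.prod[OF Gal_ring_graph[OF assms(1)], of A "\<lambda>x. x" "app R"]
      app_in[OF assms(1)] assms(2) by auto
qed

lemma Gal_prod_list:
  assumes "R \<in> Gal" and "\<And>x. x \<in> set xs \<Longrightarrow> algebraic x"
  shows "(prod_list xs, prod_list (map (app R) xs)) \<in> R"
  using assms(2)
proof (induction xs)
  case Nil
  show ?case using ring_graph.one[OF Gal_ring_graph[OF assms(1)]] by simp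
next
  case (Cons x xs)
  thus ?case
    using ring_graph.times[OF Gal_ring_graph[OF assms(1)] app_in[OF assms(1), of x]] by simp
qed

text \<open>Expanding the product, each coefficient is a signed sum of terms
  \<open>a * \<Prod>T\<close> with \<open>T\<close> a union of blocks. The set \<open>S\<close>
  collects the blocks whose constant term has been chosen so far, which makes the induction go
  through.\<close>

lemma algebraic_int_times_coeff_prod:
  assumes "finite \<B>" and "\<And>B. B \<in> \<B> \<Longrightarrow> finite B" and "disjoint \<B>"
    and "finite S" and "S \<inter> \<Union>\<B> = {}"
    and "\<And>T. T \<subseteq> S \<union> \<Union>\<B> \<Longrightarrow> algebraic_int (a * \<Prod>T)"
  shows "algebraic_int (a * \<Prod>S * coeff (\<Prod>B\<in>\<B>. monom 1 k - [:\<Prod>B :: complex:]) i)"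
  using assms
proof (induction \<B> arbitrary: S i rule: finite_induct)
  case empty
  from empty.prems(5)[of S] show ?case by (auto simp: coeff_1)
next
  case (insert B \<B>)
  let ?Q = "\<Prod>B\<in>\<B>. monom 1 k - [:\<Prod>B :: complex:]"
  have dis: "B \<inter> \<Union>\<B> = {}" "disjoint \<B>"
    using insert.prems(2) insert.hyps by (auto simp: pairwise_def disjnt_iff)
  have SB: "S \<inter> B = {}" "S \<inter> \<Union>\<B> = {}" using insert.prems(4) by auto
  have fin: "finite B" using insert.prems(1) by simp
  have T: "algebraic_int (a * \<Prod>T)" if "T \<subseteq> S \<union> B \<union> \<Union>\<B>" for T
    using insert.prems(5)[of T] that by (simp add: Un_assoc)
  have 1: "algebraic_int (a * \<Prod>S * coeff ?Q j)" for j
  proof (rule insert.IH)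
    show "algebraic_int (a * \<Prod>T)" if "T \<subseteq> S \<union> \<Union>\<B>" for T using T[of T] that by blast
  qed (use insert.prems(1,3) dis SB in auto)
  have 2: "algebraic_int (a * \<Prod>(S \<union> B) * coeff ?Q j)" for j
    using insert.prems(1,3) dis SB fin T by (intro insert.IH) auto
  have "\<Prod>(S \<union> B) = \<Prod>S * \<Prod>B" using SB fin insert.prems(3) by (intro prod.union_disjoint)
  hence "a * \<Prod>S * coeff (\<Prod>B\<in>insert B \<B>. monom 1 k - [:\<Prod>B :: complex:]) i =
      (if i < k then 0 else a * \<Prod>S * coeff ?Q (i - k)) + - (a * \<Prod>(S \<union> B) * coeff ?Q i)"
    using insert.hyps by (simp add: left_diff_distrib coeff_monom_mult algebra_simps)
  moreover have "algebraic_int \<dots>"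
    using 1 2 by (intro algebraic_int_plus_complex algebraic_int_minus) auto
  ultimately show ?case by simp
qed

lemma ex_complex_root:
  assumes "k > 0"
  shows "\<exists>z. z ^ k = (w :: complex)"
proof -
  have "\<not> constant (poly (monom 1 k - [:w:]))"
    using degree_monom_minus_const[OF assms] assms by (simp add: constant_degree)
  thus ?thesis using Fundamental_Theorem_Algebra.fundamental_theorem_of_algebra by (fastforce simp: poly_monom)
qed

lemma mahler_root_of_unity:
  assumes "k > 0" and "z ^ k = 1"
  shows "algebraic z" and "mahler z = 0"
proof -
  let ?p = "monom 1 k - [:1:] :: int poly"
  have eq: "map_poly complex_of_int ?p = monom 1 k - [:1:]"
    by (intro poly_eqI) (auto simp: coeff_map_poly coeff_pCons split: nat.splits)
  have root: "poly (map_poly of_int ?p) z = 0" using assms by (simp add: eq poly_monom)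
  have "degree (monom 1 k - [:1:] :: complex poly) \<noteq> 0" using assms by (simp add: degree_monom_minus_const)
  hence nz: "?p \<noteq> 0" using eq by fastforce
  show z: "algebraic z" by (rule algebraic_of_int_poly[OF nz root])
  have "mahler z \<le> log_plus 1"
    using mahler_le_poly_mahler[OF nz root] poly_mahler_monom_minus_const[OF assms(1), of 1]
    by (simp add: eq)
  thus "mahler z = 0" using mahler_nonneg[OF z] by (simp add: log_plus_def)
qed

locale algebraic_number =
  fixes \<alpha> :: complex
  assumes alg: "algebraic \<alpha>"
begin

text \<open>The subgroup fixing the splitting field \<open>K\<close> of the minimal polynomial of \<open>\<alpha>\<close>. Up to its
  sign, \<open>N x\<close> is the constant coefficient of the minimal polynomial of \<open>x\<close> over \<open>K\<close>.\<close>

definition H :: "(complex \<times> complex) set set" where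
  "H = {R \<in> Gal. \<forall>x\<in>conjs \<alpha>. (x, x) \<in> R}"

definition orb :: "complex \<Rightarrow> complex set" where
  "orb x = {y. \<exists>R\<in>H. (x, y) \<in> R}"

definition N :: "complex \<Rightarrow> complex" where
  "N x = \<Prod>(orb x)"

lemma H_Gal: "R \<in> H \<Longrightarrow> R \<in> Gal"
  by (simp add: H_def)

lemma H_ring_graph: "R \<in> H \<Longrightarrow> ring_graph R"
  by (simp add: H_Gal Gal_ring_graph)

lemma H_Id: "Id \<in> H"
  by (simp add: H_def Gal_Id)

lemma H_converse: "R \<in> H \<Longrightarrow> R\<inverse> \<in> H"
  by (simp add: H_def Gal_converse)

lemma H_relcomp: "R \<in> H \<Longrightarrow> S \<in> H \<Longrightarrow> R O S \<in> H"
  by (auto simp: H_def Gal_relcomp)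

text \<open>Automorphisms permute the conjugates of \<alpha>, so moving a conjugate back by
  \<open>R\<close>, fixing it by \<open>S\<close> and moving it forward again returns it to
  itself.\<close>

lemma H_normal:
  assumes R: "R \<in> Gal" and S: "S \<in> H"
  shows "R\<inverse> O S O R \<in> H"
proof -
  have "(c, c) \<in> R\<inverse> O S O R" if c: "c \<in> conjs \<alpha>" for c
  proof -
    have "algebraic c" using conjs_algebraic[OF alg c] .
    then obtain c' where c': "(c, c') \<in> R\<inverse>" using Gal_obtain_image Gal_converse[OF R] by blast
    have "c' \<in> conjs \<alpha>"
      using Gal_conjs[OF Gal_converse[OF R] \<open>algebraic c\<close> c'] conjs_eq[OF alg c] by simp
    thus ?thesis using S c' by (auto simp: H_def)
  qed
  thus ?thesis using R S by (simp add: H_def Gal_relcomp Gal_converse)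
qed

lemma orb_self: "x \<in> orb x"
  using H_Id by (auto simp: orb_def)

lemma orb_subset_conjs: "algebraic x \<Longrightarrow> orb x \<subseteq> conjs x"
  using Gal_conjs H_Gal by (auto simp: orb_def)

lemma finite_orb: "algebraic x \<Longrightarrow> finite (orb x)"
  using finite_subset[OF orb_subset_conjs finite_conjs] .

lemma card_orb_pos: "algebraic x \<Longrightarrow> card (orb x) > 0"
  using finite_orb orb_self by (auto simp: card_gt_0_iff)

lemma orb_algebraic: "algebraic x \<Longrightarrow> orb x \<subseteq> Collect algebraic"
  using orb_subset_conjs conjs_algebraic by blast

lemma orb_eq:
  assumes "y \<in> orb x"
  shows "orb y = orb x"
proof -
  have sub: "orb y \<subseteq> orb x" if "y \<in> orb x" for x y
    using that H_relcomp unfolding orb_def by blast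
  have "x \<in> orb y" using assms H_converse unfolding orb_def by blast
  thus ?thesis using sub assms by blast
qed

text \<open>By \<open>H_normal\<close>, automorphisms map orbits of \<open>H\<close> into orbits;
  the same inclusion for the converse gives equality.\<close>

lemma orb_Image:
  assumes R: "R \<in> Gal" and x: "algebraic x" and xy: "(x, y) \<in> R"
  shows "R `` orb x = orb y"
proof -
  have sub: "R `` orb x \<subseteq> orb y" if R: "R \<in> Gal" and xy: "(x, y) \<in> R" for R x y
  proof
    fix w assume "w \<in> R `` orb x"
    then obtain v S where S: "S \<in> H" "(x, v) \<in> S" "(v, w) \<in> R" by (auto simp: orb_def)
    have "(y, w) \<in> R\<inverse> O S O R" 
      by (rule relcompI[OF converseI[OF xy] relcompI[OF S(2,3)]])
    thus "w \<in> orb y" unfolding orb_def mem_Collect_eq by (rule bexI[OF _ H_normal[OF R S(1)]])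
  qed
  have "orb y \<subseteq> R `` orb x"
  proof
    fix w assume w: "w \<in> orb y"
    have "algebraic w" using w orb_algebraic Gal_algebraic[OF R x xy] by blast
    then obtain v where v: "(w, v) \<in> R\<inverse>" using Gal_obtain_image Gal_converse[OF R] by blast
    moreover have "R\<inverse> `` orb y \<subseteq> orb x" using xy by (intro sub Gal_converse R) simp
    ultimately have "v \<in> orb x" using w by blast
    thus "w \<in> R `` orb x" using v by blast
  qed
  thus ?thesis using sub[OF R xy] by blast
qed

lemma N_fixed:
  assumes "algebraic x" and "R \<in> H"
  shows "(N x, N x) \<in> R"
proof -
  note R = H_Gal[OF assms(2)]
  obtain y where y: "(x, y) \<in> R" using Gal_obtain_image[OF R assms(1)] .
  hence "R `` orb x = orb x" using orb_Image[OF R assms(1)] orb_eq[of y x] assms(2) by (auto simp: orb_def)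
  thus ?thesis using Gal_prod_Image[OF R orb_algebraic[OF assms(1)]] by (simp add: N_def)
qed

lemma N_nonzero:
  assumes "algebraic x" and "x \<noteq> 0"
  shows "N x \<noteq> 0"
proof -
  have "0 \<notin> orb x" using assms(2) ring_graph.zero_iff[OF H_ring_graph] by (auto simp: orb_def)
  thus ?thesis using finite_orb[OF assms(1)] by (simp add: N_def prod_zero_iff)
qed

section \<open>An integer polynomial vanishing at the roots of a norm\<close>

definition blocks :: "complex \<Rightarrow> complex set set" where
  "blocks x = orb ` conjs x"

definition block_poly :: "complex \<Rightarrow> nat \<Rightarrow> complex poly" where
  "block_poly x k = smult (of_int (lead_coeff (min_int_poly x)))
     (\<Prod>B\<in>blocks x. monom 1 k - [:\<Prod>B:])"

context
  fixes x :: complex assumes x: "algebraic x"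
begin

lemma blocks_subset: "B \<in> blocks x \<Longrightarrow> B \<subseteq> conjs x"
  using conjs_eq[OF x] conjs_algebraic[OF x] orb_subset_conjs by (fastforce simp: blocks_def)

lemma blocks_algebraic: "B \<in> blocks x \<Longrightarrow> B \<subseteq> Collect algebraic"
  using blocks_subset conjs_algebraic[OF x] by blast

lemma finite_blocks: "finite (blocks x)"
  by (simp add: blocks_def finite_conjs[OF x])

lemma finite_block: "B \<in> blocks x \<Longrightarrow> finite B"
  using finite_subset[OF blocks_subset finite_conjs[OF x]] .

lemma Union_blocks: "\<Union>(blocks x) = conjs x"
  using blocks_subset orb_self by (fastforce simp: blocks_def)

lemma disjoint_blocks: "disjoint (blocks x)"
proof (rule disjointI)
  fix B C assume "B \<in> blocks x" "C \<in> blocks x" "B \<noteq> C"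
  then obtain y z where "B = orb y" "C = orb z" by (auto simp: blocks_def)
  thus "B \<inter> C = {}" using orb_eq \<open>B \<noteq> C\<close> by blast
qed

lemma blocks_Image:
  assumes R: "R \<in> Gal"
  shows "bij_betw (\<lambda>B. R `` B) (blocks x) (blocks x)"
proof -
  have "R `` B \<in> blocks x" if "B \<in> blocks x" for B
  proof -
    obtain y where y: "y \<in> conjs x" "B = orb y" using \<open>B \<in> blocks x\<close> by (auto simp: blocks_def)
    have y': "algebraic y" by (rule conjs_algebraic[OF x y(1)])
    obtain z where z: "(y, z) \<in> R" using Gal_obtain_image[OF R y'] .
    hence "z \<in> conjs x" using Gal_conjs[OF R y' z] conjs_eq[OF x y(1)] by simp
    thus ?thesis using orb_Image[OF R y' z] y by (auto simp: blocks_def)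
  qed
  moreover have "inj_on (\<lambda>B. R `` B) (blocks x)"
    by (rule inj_onI) (metis Gal_Image_converse[OF R] blocks_algebraic)
  ultimately show ?thesis
    using endo_inj_surj[OF finite_blocks, of "\<lambda>B. R `` B"] by (simp add: bij_betw_def image_subset_iff)
qed

text \<open>By \<open>blocks_Image\<close> an automorphism merely permutes the factors.\<close>

lemma block_poly_fixed:
  assumes R: "R \<in> Gal"
  shows "(coeff (block_poly x k) i, coeff (block_poly x k) i) \<in> R"
proof -
  interpret ring_graph R by (rule Gal_ring_graph[OF R])
  have "(\<Prod>B\<in>blocks x. monom 1 k - [:\<Prod>B:], \<Prod>B\<in>blocks x. monom 1 k - [:\<Prod>(R `` B):]) \<in> pol"
    by (intro pol_prod pol_diff pol_monom pol_const one Gal_prod_Image R blocks_algebraic)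
  also have "(\<Prod>B\<in>blocks x. monom 1 k - [:\<Prod>(R `` B):]) = (\<Prod>B\<in>blocks x. monom 1 k - [:\<Prod>B:])"
    by (rule prod.reindex_bij_betw[OF blocks_Image[OF R], of "\<lambda>B. monom 1 k - [:\<Prod>B:]"])
  finally show ?thesis
    unfolding block_poly_def coeff_smult by (intro times of_int polD)
qed

text \<open>The coefficients are algebraic integers, because the leading coefficient times any
  product of distinct conjugates is one; being fixed by all automorphisms, they are also
  rational.\<close>

lemma block_poly_Ints: "coeff (block_poly x k) i \<in> \<int>"
proof -
  let ?a = "complex_of_int (lead_coeff (min_int_poly x))"
  have "algebraic_int (coeff (map_poly complex_of_int (min_int_poly x)) i)" for i
    by (intro int_imp_algebraic_int) (simp add: coeff_map_poly)
  hence "algebraic_int (?a * \<Prod>T)" if "T \<subseteq> conjs x" for T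
    using algebraic_int_lead_coeff_times_roots[OF finite_conjs[OF x] _ that]
    unfolding min_int_poly_conv_prod[OF x] by blast
  hence "algebraic_int (?a * \<Prod>{} * coeff (\<Prod>B\<in>blocks x. monom 1 k - [:\<Prod>B :: complex:]) i)"
    by (intro algebraic_int_times_coeff_prod[OF finite_blocks finite_block disjoint_blocks])
      (auto simp: Union_blocks)
  hence int: "algebraic_int (coeff (block_poly x k) i)" by (simp add: block_poly_def)
  hence "coeff (block_poly x k) i \<in> \<rat>"
    by (intro Gal_fixed_rational block_poly_fixed) auto
  thus ?thesis by (rule rational_algebraic_int_is_int[OF int])
qed

text \<open>Whatever \<open>k\<close> is, a block contributes the \<open>log_plus\<close> of the
  modulus of its product, at most the sum of \<open>log_plus\<close> over its elements; the blocks
  partition the conjugates.\<close>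

lemma poly_mahler_block_poly:
  assumes "k > 0"
  shows "poly_mahler (block_poly x k) \<le> mahler x"
    and "block_poly x k \<noteq> 0"
proof -
  let ?a = "lead_coeff (min_int_poly x)" and ?f = "\<lambda>B. monom 1 k - [:\<Prod>B :: complex:]"
  have a: "?a > 0" by (rule min_int_polyD[OF x])
  have f0: "?f B \<noteq> 0" for B
    using degree_monom_minus_const[OF assms, of "\<Prod>B"] assms by fastforce
  hence nz: "prod ?f (blocks x) \<noteq> 0" using finite_blocks by (simp add: prod_zero_iff)
  thus "block_poly x k \<noteq> 0" using min_int_polyD(4)[OF x] by (simp add: block_poly_def)
  have "poly_mahler (block_poly x k) = ln (of_int ?a) + (\<Sum>B\<in>blocks x. log_plus (cmod (\<Prod>B)))"
    using a nz f0 poly_mahler_monom_minus_const[OF assms] unfolding block_poly_def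
    by (subst poly_mahler_smult) (auto simp: poly_mahler_prod)
  also have "\<dots> \<le> ln (of_int ?a) + (\<Sum>B\<in>blocks x. \<Sum>y\<in>B. log_plus (cmod y))"
    by (intro add_left_mono sum_mono log_plus_prod_le)
  also have "(\<Sum>B\<in>blocks x. \<Sum>y\<in>B. log_plus (cmod y)) = (\<Sum>y\<in>conjs x. log_plus (cmod y))"
    using disjoint_blocks finite_block
    by (subst Union_blocks[symmetric], subst sum.Union_disjoint) (auto simp: disjoint_def)
  finally show "poly_mahler (block_poly x k) \<le> mahler x" by (simp add: mahler_conv_conjs[OF x])
qed

text \<open>Such a \<open>z\<close> is a root of the factor of \<open>block_poly x k\<close>
  belonging to the block \<open>orb x\<close>. The exponent \<open>card (orb x)\<close> serves to
  replace a factor, the exponent 1 to compare \<open>N x\<close> with \<open>x\<close>.\<close>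

lemma mahler_norm_root_le:
  assumes "k > 0" and "z ^ k = N x"
  shows "algebraic z" and "mahler z \<le> mahler x"
proof -
  define p where "p = map_poly (\<lambda>c. \<lfloor>Re c\<rfloor>) (block_poly x k)"
  have p: "map_poly of_int p = block_poly x k"
  proof (rule poly_eqI)
    fix i
    obtain n :: int where "coeff (block_poly x k) i = of_int n" using block_poly_Ints by (metis Ints_cases)
    thus "coeff (map_poly of_int p) i = coeff (block_poly x k) i"
      by (simp add: p_def coeff_map_poly)
  qed
  have "orb x \<in> blocks x" using self_in_conjs[OF x] by (simp add: blocks_def)
  hence root: "poly (map_poly of_int p) z = 0"
    using assms(2) finite_blocks unfolding p
    by (auto simp: block_poly_def poly_prod poly_monom N_def intro!: prod_zero)
  have nz: "p \<noteq> 0" using poly_mahler_block_poly(2)[OF assms(1)] p by force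
  show "algebraic z" by (rule algebraic_of_int_poly[OF nz root])
  show "mahler z \<le> mahler x"
    using mahler_le_poly_mahler[OF nz root] poly_mahler_block_poly(1)[OF assms(1)] by (simp add: p)
qed

end

section \<open>A uniform gap for the measures of roots of norms\<close>

lemma degree_fixed_le:
  assumes d: "algebraic d" and fixed: "\<And>R. R \<in> H \<Longrightarrow> (d, d) \<in> R"
  shows "degree (min_int_poly d) \<le> 2 ^ (card (conjs \<alpha>) * card (conjs \<alpha>))"
proof -
  let ?C = "conjs \<alpha>"
  have "\<forall>y\<in>conjs d. \<exists>R\<in>Gal. (d, y) \<in> R" using ex_Gal_conj[OF d] by blast
  then obtain \<rho> where \<rho>: "\<And>y. y \<in> conjs d \<Longrightarrow> \<rho> y \<in> Gal" "\<And>y. y \<in> conjs d \<Longrightarrow> (d, y) \<in> \<rho> y"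
    by metis
  \<comment> \<open>As \<open>d\<close> is fixed by \<open>H\<close>, its image under an
    automorphism depends only on the action on \<open>conjs \<alpha>\<close>. Counting all relations
    on this finite set gives the crude bound.\<close>
  have "inj_on (\<lambda>y. \<rho> y \<inter> ?C \<times> ?C) (conjs d)"
  proof (rule inj_onI)
    fix y z assume yz: "y \<in> conjs d" "z \<in> conjs d" and eq: "\<rho> y \<inter> ?C \<times> ?C = \<rho> z \<inter> ?C \<times> ?C"
    have "(c, c) \<in> \<rho> y O (\<rho> z)\<inverse>" if c: "c \<in> ?C" for c
    proof -
      have "algebraic c" by (rule conjs_algebraic[OF alg c])
      then obtain c' where c': "(c, c') \<in> \<rho> y" using Gal_obtain_image \<rho>(1)[OF yz(1)] by blast
      have "c' \<in> ?C"
        using Gal_conjs[OF \<rho>(1)[OF yz(1)] \<open>algebraic c\<close> c'] conjs_eq[OF alg c] by simp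
      thus ?thesis using c c' eq by blast
    qed
    hence "\<rho> y O (\<rho> z)\<inverse> \<in> H" using \<rho>(1) yz by (auto simp: H_def Gal_relcomp Gal_converse)
    hence "(d, d) \<in> \<rho> y O (\<rho> z)\<inverse>" by (rule fixed)
    then obtain w where w: "(d, w) \<in> \<rho> y" "(d, w) \<in> \<rho> z" by blast
    hence "w = y" "w = z"
      using app_eq \<rho> yz by metis+
    thus "y = z" by simp
  qed
  hence "card (conjs d) \<le> card (Pow (?C \<times> ?C))"
    using finite_conjs[OF alg] by (intro card_inj_on_le[of "\<lambda>y. \<rho> y \<inter> ?C \<times> ?C"]) auto
  thus ?thesis using finite_conjs[OF alg] by (simp add: degree_min_int_poly[OF d] card_Pow)
qed

text \<open>Let m and l be the sizes of the orbits of \<open>x\<close> and \<open>z\<close>. As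
  \<open>N x\<close> is fixed by \<open>H\<close>, every element of the orbit of \<open>z\<close>
  has m-th power \<open>N x\<close>, whence \<open>z ^ (m * l) = N z ^ m\<close>. Integrality and
  the bound on conjugates then pass from \<open>N z\<close> to \<open>z\<close>.\<close>

lemma mahler_norm_eq_0_imp:
  assumes x: "algebraic x" and z: "z ^ card (orb x) = N x" and 0: "mahler (N z) = 0"
  shows "mahler z = 0"
proof -
  define m where "m = card (orb x)"
  have m: "m > 0" "z ^ m = N x" using card_orb_pos[OF x] z by (auto simp: m_def)
  have az: "algebraic z" using mahler_norm_root_le(1)[OF x m] .
  define l where "l = card (orb z)"
  have l: "l > 0" using card_orb_pos[OF az] by (simp add: l_def)
  have "y ^ m = N x" if y: "y \<in> orb z" for y
  proof -
    obtain R where R: "R \<in> H" "(z, y) \<in> R" using y by (auto simp: orb_def)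
    interpret ring_graph R by (rule H_ring_graph[OF R(1)])
    show ?thesis using eq_iff[OF power[OF R(2)] N_fixed[OF x R(1)], of m] m(2) by simp
  qed
  hence "(\<Prod>y\<in>orb z. y ^ m) = (\<Prod>y\<in>orb z. N x)" by (intro prod.cong) auto
  hence "N z ^ m = N x ^ l" by (simp add: N_def l_def prod_power_distrib)
  hence zm: "z ^ (m * l) = N z ^ m" using m(2) by (simp add: power_mult)
  have aN: "algebraic (N z)" using mahler_norm_root_le(1)[OF az, of 1 "N z"] by simp
  have N: "algebraic_int (N z)" "\<And>y. y \<in> conjs (N z) \<Longrightarrow> cmod y \<le> 1"
    using 0 mahler_eq_0_iff[OF aN] by auto
  have "algebraic_int z"
  proof (rule algebraic_int_root)
    show "algebraic_int (z ^ (m * l))" unfolding zm by (rule algebraic_int_power_complex[OF N(1)])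
    show "poly (monom 1 (m * l)) z = z ^ (m * l)" by (simp add: poly_monom)
    show "degree (monom (1 :: complex) (m * l)) > 0" using m(1) l by (simp add: degree_monom_eq)
  qed (auto simp: degree_monom_eq)
  moreover have "cmod y \<le> 1" if y: "y \<in> conjs z" for y
  proof -
    obtain R where R: "R \<in> Gal" "(z, y) \<in> R" using ex_Gal_conj[OF az y] by blast
    interpret ring_graph R by (rule Gal_ring_graph[OF R(1)])
    obtain w where w: "(N z, w) \<in> R" using Gal_obtain_image[OF R(1) aN] .
    have "y ^ (m * l) = w ^ m" using eq_iff[OF power[OF R(2)] power[OF w]] zm by blast
    hence "cmod y ^ (m * l) = cmod w ^ m" by (metis norm_power)
    also have "\<dots> \<le> 1" using N(2)[OF Gal_conjs[OF R(1) aN w]] by (simp add: power_le_one)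
    finally show ?thesis using m(1) l by (simp add: power_le_one_iff)
  qed
  ultimately show ?thesis using mahler_eq_0_iff[OF az] by blast
qed

text \<open>Although \<open>z\<close> may have large degree, \<open>N z\<close> has bounded degree
  by \<open>degree_fixed_le\<close>. Its measure is at most that of \<open>z\<close>, and it
  vanishes only if that of \<open>z\<close> does.\<close>

lemma mahler_norm_root_gap:
  "\<exists>c>0. \<forall>x z. algebraic x \<longrightarrow> z ^ card (orb x) = N x \<longrightarrow> mahler z = 0 \<or> mahler z \<ge> c"
proof -
  obtain c where c: "c > 0" "\<And>x. algebraic x \<Longrightarrow>
      degree (min_int_poly x) \<le> 2 ^ (card (conjs \<alpha>) * card (conjs \<alpha>)) \<Longrightarrow>
      mahler x = 0 \<or> mahler x \<ge> c"
    using mahler_gap_bounded_degree by metis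
  have "mahler z = 0 \<or> mahler z \<ge> c" if x: "algebraic x" and z: "z ^ card (orb x) = N x" for x z
  proof -
    have az: "algebraic z" using mahler_norm_root_le(1)[OF x card_orb_pos[OF x] z] .
    have N: "algebraic (N z)" "mahler (N z) \<le> mahler z"
      using mahler_norm_root_le[OF az, of 1 "N z"] by auto
    have "mahler (N z) = 0 \<or> mahler (N z) \<ge> c"
      using N_fixed[OF az] by (intro c(2) N(1) degree_fixed_le) auto
    thus ?thesis using mahler_norm_eq_0_imp[OF x z] N(2) by auto
  qed
  thus ?thesis using c(1) by blast
qed

section \<open>Replacing the factors of a factorization\<close>

lemma prod_tuple_orbit:
  assumes xs: "\<And>x. x \<in> set xs \<Longrightarrow> algebraic x" and prod_xs: "prod_list xs = \<alpha>"
    and z: "\<And>x. x \<in> set xs \<Longrightarrow> z x ^ card (orb x) = N x"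
  shows "\<exists>L>0. prod_list (map z xs) ^ L = \<alpha> ^ L"
proof -
  \<comment> \<open>\<open>T\<close> is the orbit of the whole tuple under the entrywise action of
    \<open>H\<close>; it is finite and each member has product \<alpha>. The product of all entries
    of all members is computed first by members and then by positions.\<close>
  define T where "T = (\<lambda>R. map (app R) xs) ` H"
  have T_alg: "algebraic y" if \<tau>: "\<tau> \<in> T" and y: "y \<in> set \<tau>" for \<tau> y
    using \<tau> y algebraic_app H_Gal xs by (auto simp: T_def)
  have len: "length \<tau> = length xs" if "\<tau> \<in> T" for \<tau> using that by (auto simp: T_def)
  have map_T: "map (app R) \<tau> \<in> T" if R: "R \<in> H" and \<tau>: "\<tau> \<in> T" for R \<tau>
  proof -
    obtain S where S: "S \<in> H" "\<tau> = map (app S) xs" using \<tau> by (auto simp: T_def)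
    have "map (app R) \<tau> = map (app (S O R)) xs"
      using S xs H_Gal R by (auto simp: app_relcomp)
    thus ?thesis using H_relcomp[OF S(1) R] by (auto simp: T_def)
  qed
  have inj_T: "inj_on (map (app R)) T" if R: "R \<in> H" for R
  proof (rule inj_onI)
    fix \<tau> \<sigma> assume \<tau>\<sigma>: "\<tau> \<in> T" "\<sigma> \<in> T" "map (app R) \<tau> = map (app R) \<sigma>"
    have "inj_on (app R) (set \<tau> \<union> set \<sigma>)"
      by (rule inj_on_subset[OF inj_on_app[OF H_Gal[OF R]]]) (use T_alg \<tau>\<sigma> in auto)
    thus "\<tau> = \<sigma>" using \<tau>\<sigma>(3) by (rule map_inj_on[rotated])
  qed
  have "T \<subseteq> {\<tau>. set \<tau> \<subseteq> \<Union>(orb ` set xs) \<and> length \<tau> = length xs}"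
    using app_in[OF H_Gal] xs by (fastforce simp: T_def orb_def)
  hence fin: "finite T"
    by (rule finite_subset) (intro finite_lists_length_eq finite_UN_I, auto intro: finite_orb xs)
  have "map (app Id) xs = xs" using app_eq[OF Gal_Id] by (simp add: map_idI)
  hence "xs \<in> T" using H_Id unfolding T_def by (metis imageI)
  hence L: "card T > 0" using fin by (auto simp: card_gt_0_iff)
  have prod_T: "prod_list \<tau> = \<alpha>" if \<tau>: "\<tau> \<in> T" for \<tau>
  proof -
    obtain R where R: "R \<in> H" "\<tau> = map (app R) xs" using \<tau> by (auto simp: T_def)
    interpret ring_graph R by (rule H_ring_graph[OF R(1)])
    have 1: "(prod_list xs, prod_list \<tau>) \<in> R"
      unfolding R(2) using xs by (intro Gal_prod_list H_Gal R(1))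
    have 2: "(\<alpha>, \<alpha>) \<in> R" using R(1) self_in_conjs[OF alg] by (auto simp: H_def)
    show ?thesis using eq_iff[OF 1 2] prod_xs by simp
  qed
  have coord: "(\<Prod>\<tau>\<in>T. \<tau> ! i) = z (xs ! i) ^ card T" if i: "i < length xs" for i
  proof -
    let ?x = "xs ! i"
    have ax: "algebraic ?x" using xs i by simp
    \<comment> \<open>Elements of \<open>H\<close> inject one fibre into another, and
      \<open>H\<close> is transitive on \<open>orb ?x\<close>. So all fibres over the orbit have
      equal size, and each orbit element occurs equally often at position \<open>i\<close>.\<close>
    define F where "F = (\<lambda>y. {\<tau> \<in> T. \<tau> ! i = y})"
    have card_le: "card (F u) \<le> card (F v)" if R: "R \<in> H" "(u, v) \<in> R" for R u v
    proof (rule card_inj_on_le)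
      show "inj_on (map (app R)) (F u)" using inj_T[OF R(1)] by (rule inj_on_subset) (auto simp: F_def)
      show "map (app R) ` F u \<subseteq> F v"
        using map_T[OF R(1)] len i app_eq[OF H_Gal[OF R(1)] R(2)] by (auto simp: F_def)
      show "finite (F v)" using fin by (simp add: F_def)
    qed
    have card_F: "card (F y) = card (F ?x)" if y: "y \<in> orb ?x" for y
    proof -
      obtain R where R: "R \<in> H" "(?x, y) \<in> R" using y by (auto simp: orb_def)
      hence "(y, ?x) \<in> R\<inverse>" by simp
      thus ?thesis using card_le[OF R] card_le[OF H_converse[OF R(1)]] by (intro antisym)
    qed
    have range: "(\<lambda>\<tau>. \<tau> ! i) ` T \<subseteq> orb ?x"
    proof (rule image_subsetI)
      fix \<tau> assume "\<tau> \<in> T"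
      then obtain R where R: "R \<in> H" "\<tau> = map (app R) xs" by (auto simp: T_def)
      thus "\<tau> ! i \<in> orb ?x" using i app_in[OF H_Gal[OF R(1)] ax] by (auto simp: orb_def)
    qed
    have "card T = (\<Sum>y\<in>orb ?x. card (F y))"
      using sum.group[OF fin finite_orb[OF ax] range, of "\<lambda>_. 1 :: nat"] by (simp add: F_def)
    also have "\<dots> = (\<Sum>y\<in>orb ?x. card (F ?x))" using card_F by (rule sum.cong[OF refl])
    finally have cT: "card T = card (orb ?x) * card (F ?x)" by simp
    have "(\<Prod>\<tau>\<in>T. \<tau> ! i) = (\<Prod>y\<in>orb ?x. \<Prod>\<tau>\<in>F y. \<tau> ! i)"
      using prod.group[OF fin finite_orb[OF ax] range, of "\<lambda>\<tau>. \<tau> ! i"] by (simp add: F_def)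
    also have "\<dots> = (\<Prod>y\<in>orb ?x. y ^ card (F ?x))"
    proof (rule prod.cong[OF refl])
      fix y assume y: "y \<in> orb ?x"
      have "(\<Prod>\<tau>\<in>F y. \<tau> ! i) = (\<Prod>\<tau>\<in>F y. y)" by (rule prod.cong) (auto simp: F_def)
      thus "(\<Prod>\<tau>\<in>F y. \<tau> ! i) = y ^ card (F ?x)" using card_F[OF y] by simp
    qed
    also have "\<dots> = N ?x ^ card (F ?x)" by (simp add: N_def prod_power_distrib)
    also have "\<dots> = z ?x ^ card T" using z[of ?x] i by (simp add: cT power_mult)
    finally show ?thesis .
  qed
  have "\<alpha> ^ card T = (\<Prod>\<tau>\<in>T. prod_list \<tau>)" using prod_T by simp
  also have "\<dots> = (\<Prod>\<tau>\<in>T. \<Prod>i<length xs. \<tau> ! i)"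
    using len by (intro prod.cong refl) (simp add: prod.list_conv_set_nth atLeast0LessThan)
  also have "\<dots> = (\<Prod>i<length xs. \<Prod>\<tau>\<in>T. \<tau> ! i)" by (rule prod.swap)
  also have "\<dots> = (\<Prod>i<length xs. z (xs ! i) ^ card T)" using coord by (intro prod.cong) auto
  also have "\<dots> = prod_list (map z xs) ^ card T"
    by (simp add: prod.list_conv_set_nth atLeast0LessThan prod_power_distrib)
  finally show ?thesis using L by metis
qed

text \<open>The constant is the same for all factorizations and all exponents, so that bounds
  derived from it survive the infimum.\<close>

lemma factorization_with_gap:
  assumes "\<alpha> \<noteq> 0"
  shows "\<exists>c>0. \<forall>\<beta>s\<in>factorizations \<alpha>. \<exists>\<gamma>s\<in>factorizations \<alpha>.
    (\<forall>t>0. (\<Sum>\<gamma>\<leftarrow>\<gamma>s. mahler \<gamma> powr t) \<le> (\<Sum>\<beta>\<leftarrow>\<beta>s. mahler \<beta> powr t)) \<and>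
    (\<forall>\<gamma>\<in>set \<gamma>s. mahler \<gamma> = 0 \<or> mahler \<gamma> \<ge> c)"
proof -
  obtain c where c: "c > 0"
    "\<And>x z. algebraic x \<Longrightarrow> z ^ card (orb x) = N x \<Longrightarrow> mahler z = 0 \<or> mahler z \<ge> c"
    using mahler_norm_root_gap by metis
  have "\<exists>\<gamma>s\<in>factorizations \<alpha>.
    (\<forall>t>0. (\<Sum>\<gamma>\<leftarrow>\<gamma>s. mahler \<gamma> powr t) \<le> (\<Sum>\<beta>\<leftarrow>\<beta>s. mahler \<beta> powr t)) \<and>
    (\<forall>\<gamma>\<in>set \<gamma>s. mahler \<gamma> = 0 \<or> mahler \<gamma> \<ge> c)" if \<beta>s: "\<beta>s \<in> factorizations \<alpha>" for \<beta>s
  proof -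
    have \<beta>: "\<And>\<beta>. \<beta> \<in> set \<beta>s \<Longrightarrow> algebraic \<beta> \<and> \<beta> \<noteq> 0" "prod_list \<beta>s = \<alpha>"
      using \<beta>s by (auto simp: factorizations_def)
    have "\<forall>x\<in>set \<beta>s. \<exists>z. z ^ card (orb x) = N x"
      using \<beta>(1) card_orb_pos ex_complex_root by blast
    then obtain z where z: "\<And>x. x \<in> set \<beta>s \<Longrightarrow> z x ^ card (orb x) = N x" by metis
    have za: "algebraic (z x)" "mahler (z x) \<le> mahler x" if "x \<in> set \<beta>s" for x
      using mahler_norm_root_le[OF _ card_orb_pos z[OF that]] \<beta>(1)[OF that] by auto
    have z0: "z x \<noteq> 0" if "x \<in> set \<beta>s" for x
      using N_nonzero[of x] \<beta>(1)[OF that] z[OF that] card_orb_pos[of x] by (auto simp: power_0_left)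
    define P where "P = prod_list (map z \<beta>s)"
    have P: "P \<noteq> 0" using z0 by (auto simp: P_def prod_list_zero_iff)
    obtain L where L: "L > 0" "P ^ L = \<alpha> ^ L"
      unfolding P_def using prod_tuple_orbit[OF _ \<beta>(2) z] \<beta>(1) by blast
    \<comment> \<open>The product of the roots misses \<alpha> by a root of unity, which is added as
      one more factor. Its measure is 0 and \<open>0 powr t = 0\<close>, so the power sums do not
      change.\<close>
    define \<zeta> where "\<zeta> = \<alpha> / P"
    have "\<zeta> ^ L = 1" using L(2)[symmetric] P by (simp add: \<zeta>_def power_divide)
    note \<zeta> = mahler_root_of_unity[OF L(1) this]
    show ?thesis
    proof (intro bexI[of _ "\<zeta> # map z \<beta>s"] conjI allI impI ballI)
      show "\<zeta> # map z \<beta>s \<in> factorizations \<alpha>"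
        using \<zeta> za z0 P assms by (auto simp: factorizations_def \<zeta>_def P_def)
      fix t :: real assume t: "t > 0"
      have "(\<Sum>\<beta>\<leftarrow>\<beta>s. mahler (z \<beta>) powr t) \<le> (\<Sum>\<beta>\<leftarrow>\<beta>s. mahler \<beta> powr t)"
        using za mahler_nonneg t by (intro sum_list_mono powr_mono2) auto
      thus "(\<Sum>\<gamma>\<leftarrow>\<zeta> # map z \<beta>s. mahler \<gamma> powr t) \<le> (\<Sum>\<beta>\<leftarrow>\<beta>s. mahler \<beta> powr t)"
        using \<zeta>(2) by (simp add: comp_def)
    next
      fix \<gamma> assume "\<gamma> \<in> set (\<zeta> # map z \<beta>s)"
      thus "mahler \<gamma> = 0 \<or> mahler \<gamma> \<ge> c" using \<zeta>(2) c(2) z \<beta>(1) by auto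
    qed
  qed
  thus ?thesis using c(1) by blast
qed

end

section \<open>Metric Mahler measures as functions of the exponent\<close>

text \<open>The common form of \<open>seq_norm\<close> and of the terms in
  \<open>metric_mahler\<close> at finite exponents.\<close>

definition pnorm :: "real list \<Rightarrow> real \<Rightarrow> real" where
  "pnorm ms t = (\<Sum>m\<leftarrow>ms. m powr t) powr (1 / t)"

lemma power_sum_nonneg: "(\<Sum>m\<leftarrow>ms. m powr t) \<ge> (0 :: real)"
  by (intro sum_list_nonneg) auto

lemma pnorm_nonneg: "pnorm ms t \<ge> 0"
  by (simp add: pnorm_def)

lemma pnorm_powr: "t > 0 \<Longrightarrow> pnorm ms t powr t = (\<Sum>m\<leftarrow>ms. m powr t)"
  using power_sum_nonneg[of t ms] by (simp add: pnorm_def powr_powr)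

text \<open>Every entry m is at most the norm q at exponent \<open>s\<close>, so m^t \<le> m^s
  q^(t-s); summing gives q^t.\<close>

lemma pnorm_antimono:
  assumes "\<And>m. m \<in> set ms \<Longrightarrow> m \<ge> 0" and "0 < s" and "s \<le> t"
  shows "pnorm ms t \<le> pnorm ms s"
proof -
  define q where "q = pnorm ms s"
  have q0: "q \<ge> 0" by (simp add: q_def pnorm_nonneg)
  have qs: "q powr s = (\<Sum>m\<leftarrow>ms. m powr s)" using pnorm_powr[OF assms(2)] by (simp add: q_def)
  have le: "m \<le> q" if "m \<in> set ms" for m
  proof -
    have "m powr s \<le> (\<Sum>m\<leftarrow>ms. m powr s)"
      using that by (intro member_le_sum_list) auto
    hence "(m powr s) powr (1 / s) \<le> q"
      unfolding q_def pnorm_def using assms(2) by (intro powr_mono2) auto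
    thus ?thesis using assms(1)[OF that] assms(2) by (simp add: powr_powr)
  qed
  have "(\<Sum>m\<leftarrow>ms. m powr t) \<le> (\<Sum>m\<leftarrow>ms. m powr s * q powr (t - s))"
  proof (rule sum_list_mono)
    fix m assume m: "m \<in> set ms"
    have "m powr t = m powr s * m powr (t - s)" by (simp flip: powr_add)
    also have "\<dots> \<le> m powr s * q powr (t - s)"
      using assms le[OF m] m by (intro mult_left_mono powr_mono2) auto
    finally show "m powr t \<le> m powr s * q powr (t - s)" .
  qed
  also have "\<dots> = q powr s * q powr (t - s)" by (simp add: qs sum_list_mult_const)
  also have "\<dots> = q powr t" by (simp flip: powr_add)
  finally have "pnorm ms t \<le> (q powr t) powr (1 / t)"
    unfolding pnorm_def using assms power_sum_nonneg by (intro powr_mono2) auto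
  also have "\<dots> = q" using assms q0 by (simp add: powr_powr)
  finally show ?thesis by (simp add: q_def)
qed

lemma tendsto_power_sum:
  fixes ms :: "real list"
  shows "((\<lambda>t. \<Sum>m\<leftarrow>ms. m powr t) \<longlongrightarrow> (\<Sum>m\<leftarrow>ms. m powr s)) (at s within A)"
proof (induction ms)
  case (Cons m ms)
  have "((\<lambda>t. m powr t) \<longlongrightarrow> m powr s) (at s within A)"
    by (cases "m = 0") (auto intro!: tendsto_intros)
  thus ?case using Cons by (auto intro!: tendsto_intros)
qed auto

lemma tendsto_pnorm:
  assumes "s > 0"
  shows "(pnorm ms \<longlongrightarrow> pnorm ms s) (at s within A)"
\<comment> \<open>The limit rule for \<open>powr\<close> needs a nonzero base, so lists of zeros are
  treated apart.\<close>
proof (cases "\<forall>m\<in>set ms. m = 0")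
  case True
  hence "(\<Sum>m\<leftarrow>ms. m powr t) = 0" for t by (induction ms) auto
  hence "pnorm ms = (\<lambda>_. 0)" by (auto simp: pnorm_def)
  thus ?thesis by simp
next
  case False
  then obtain m where m: "m \<in> set ms" "m \<noteq> 0" by blast
  have "m powr s \<le> (\<Sum>m\<leftarrow>ms. m powr s)" using m by (intro member_le_sum_list) auto
  moreover have "m powr s > 0" using m by simp
  ultimately have "(\<Sum>m\<leftarrow>ms. m powr s) \<noteq> 0" by linarith
  thus ?thesis
    unfolding pnorm_def[abs_def] using assms by (intro tendsto_intros tendsto_power_sum) auto
qed

text \<open>Both power sums extend to entire functions of the exponent, so the identity theorem
  carries the equality from an interval to every \<open>t\<close>.\<close>

lemma power_sums_eq_analytic:
  fixes ms ns :: "real list" and p q t :: real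
  assumes nn: "\<And>m. m \<in> set ms \<union> set ns \<Longrightarrow> m \<ge> 0" and "p < q"
    and eq: "\<And>t. p < t \<Longrightarrow> t < q \<Longrightarrow> (\<Sum>m\<leftarrow>ms. m powr t) = (\<Sum>m\<leftarrow>ns. m powr t)"
  shows "(\<Sum>m\<leftarrow>ms. m powr t) = (\<Sum>m\<leftarrow>ns. m powr t)"
proof -
  \<comment> \<open>A zero entry must give the zero function, in accordance with
    \<open>0 powr t = 0\<close>.\<close>
  define g where "g = (\<lambda>(m :: real) (w :: complex). if m = 0 then 0 else exp (w * of_real (ln m)))"
  define f where "f = (\<lambda>ms w. \<Sum>m\<leftarrow>ms. g m w)"
  have g: "g m (of_real t) = of_real (m powr t)" if "m \<ge> 0" for m t
    using that by (auto simp: g_def powr_def exp_of_real[symmetric])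
  have f: "f ms (of_real t) = of_real (\<Sum>m\<leftarrow>ms. m powr t)" if "\<And>m. m \<in> set ms \<Longrightarrow> m \<ge> 0" for ms t
    using that by (induction ms) (auto simp: f_def g)
  have "g m holomorphic_on UNIV" for m
    by (cases "m = 0") (auto simp: g_def intro!: holomorphic_intros)
  hence holo: "f ms holomorphic_on UNIV" for ms
    by (induction ms) (auto simp: f_def intro!: holomorphic_intros)
  let ?\<xi> = "complex_of_real ((p + q) / 2)" and ?U = "of_real ` {p<..<q} :: complex set"
  have "?\<xi> islimpt ?U"
    unfolding islimpt_approachable
  proof (intro allI impI)
    fix e :: real assume e: "e > 0"
    define d where "d = min (e / 2) ((q - p) / 4)"
    have d: "d > 0" "d < e" "d \<le> (q - p) / 4" using e \<open>p < q\<close> by (auto simp: d_def min_def field_simps)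
    have "of_real ((p + q) / 2 + d) \<in> ?U" using d by (intro imageI) (auto simp: field_simps)
    moreover have "complex_of_real ((p + q) / 2 + d) \<noteq> ?\<xi>" using d by (simp only: of_real_eq_iff)
    moreover have "dist (complex_of_real ((p + q) / 2 + d)) ?\<xi> < e"
      using d by (simp only: dist_of_real) (simp add: dist_real_def)
    ultimately show "\<exists>x'\<in>?U. x' \<noteq> ?\<xi> \<and> dist x' ?\<xi> < e" by blast
  qed
  moreover have "f ms w - f ns w = 0" if "w \<in> ?U" for w
    using that f nn eq by auto
  ultimately have "f ms (of_real t) - f ns (of_real t) = 0"
    by (rule analytic_continuation[of "\<lambda>w. f ms w - f ns w" UNIV ?U ?\<xi>, rotated 5])
      (simp_all add: holo holomorphic_on_diff convex_connected)
  hence "f ms (of_real t) = f ns (of_real t)" by simp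
  hence "complex_of_real (\<Sum>m\<leftarrow>ms. m powr t) = of_real (\<Sum>m\<leftarrow>ns. m powr t)"
    using nn by (subst (asm) (1 2) f) auto
  thus ?thesis by (simp only: of_real_eq_iff)
qed

lemma pnorm_eq_analytic:
  assumes "\<And>m. m \<in> set ms \<union> set ns \<Longrightarrow> m \<ge> 0" and "0 \<le> p" and "p < q"
    and "\<And>t. p < t \<Longrightarrow> t < q \<Longrightarrow> pnorm ms t = pnorm ns t"
  shows "pnorm ms t = pnorm ns t"
proof -
  have "(\<Sum>m\<leftarrow>ms. m powr t) = (\<Sum>m\<leftarrow>ns. m powr t)" if "p < t" "t < q" for t
    using assms(2,4) that pnorm_powr[of t ms] pnorm_powr[of t ns] by simp
  from power_sums_eq_analytic[OF assms(1,3) this] show ?thesis by (simp add: pnorm_def)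
qed

definition abs_list :: "(nat \<Rightarrow> real) \<Rightarrow> real list" where
  "abs_list x = map (\<lambda>n. \<bar>x n\<bar>) (sorted_list_of_set {n. x n \<noteq> 0})"

lemma abs_list_nonneg: "m \<in> set (abs_list x) \<Longrightarrow> m \<ge> 0"
  by (auto simp: abs_list_def)

lemma seq_norm_conv_pnorm:
  assumes "x \<in> fin_seqs"
  shows "seq_norm (ereal t) x = pnorm (abs_list x) t"
  using assms
  by (simp add: seq_norm_def pnorm_def abs_list_def fin_seqs_def comp_def sum_list_distinct_conv_sum_set)

lemma metric_mahler_conv_pnorm:
  "metric_mahler (ereal t) \<alpha> = (INF \<beta>s\<in>factorizations \<alpha>. pnorm (map mahler \<beta>s) t)"
  by (simp add: metric_mahler_def pnorm_def comp_def)

lemma metric_mahler_le: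
  assumes "\<beta>s \<in> factorizations \<alpha>"
  shows "metric_mahler (ereal t) \<alpha> \<le> pnorm (map mahler \<beta>s) t"
  unfolding metric_mahler_conv_pnorm
  using assms by (intro cINF_lower bdd_belowI2[of _ 0]) (auto simp: pnorm_nonneg)

lemma factorizations_mahler_nonneg:
  "\<beta>s \<in> factorizations \<alpha> \<Longrightarrow> m \<in> set (map mahler \<beta>s) \<Longrightarrow> m \<ge> 0"
  by (auto simp: factorizations_def mahler_nonneg)

section \<open>Continuity of metric Mahler measures at end points\<close>

context
  fixes \<alpha> :: complex
  assumes alg: "algebraic \<alpha>" and nz: "\<alpha> \<noteq> 0"
begin

lemma le_metric_mahler:
  assumes "\<And>\<beta>s. \<beta>s \<in> factorizations \<alpha> \<Longrightarrow> v \<le> pnorm (map mahler \<beta>s) t"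
  shows "v \<le> metric_mahler (ereal t) \<alpha>"
proof -
  \<comment> \<open>The trivial factorization makes the infimum one over a nonempty set.\<close>
  have "[\<alpha>] \<in> factorizations \<alpha>" using alg nz by (simp add: factorizations_def)
  thus ?thesis unfolding metric_mahler_conv_pnorm using assms by (intro cINF_greatest) auto
qed

lemma metric_mahler_nonneg: "metric_mahler (ereal t) \<alpha> \<ge> 0"
  by (rule le_metric_mahler) (rule pnorm_nonneg)

lemma metric_mahler_antimono:
  assumes "0 < s" and "s \<le> t"
  shows "metric_mahler (ereal t) \<alpha> \<le> metric_mahler (ereal s) \<alpha>"
proof (rule le_metric_mahler)
  fix \<beta>s assume \<beta>s: "\<beta>s \<in> factorizations \<alpha>"
  have "pnorm (map mahler \<beta>s) t \<le> pnorm (map mahler \<beta>s) s"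
    by (rule pnorm_antimono) (use factorizations_mahler_nonneg[OF \<beta>s] assms in auto)
  thus "metric_mahler (ereal t) \<alpha> \<le> pnorm (map mahler \<beta>s) s"
    using metric_mahler_le[OF \<beta>s, of t] by linarith
qed

text \<open>Monotonicity gives one inequality. For the other, the norm of each single factorization
  bounds \<open>pnorm ms\<close> to the left of \<open>q\<close>, and both are continuous at
  \<open>q\<close>.\<close>

lemma metric_mahler_right_endpoint:
  assumes "0 \<le> p" and "p < q"
    and eq: "\<And>t. p < t \<Longrightarrow> t < q \<Longrightarrow> metric_mahler (ereal t) \<alpha> = pnorm ms t"
  shows "metric_mahler (ereal q) \<alpha> = pnorm ms q"
proof (rule antisym)
  have ev: "eventually (\<lambda>t. p < t \<and> t < q) (at_left q)"
    using eventually_at_left_real[OF assms(2)] by (auto elim: eventually_mono)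
  have "q > 0" using assms by simp
  note lim = tendsto_pnorm[OF this, of _ "{..<q}"]
  show "metric_mahler (ereal q) \<alpha> \<le> pnorm ms q"
  proof (rule tendsto_lowerbound[OF lim])
    show "eventually (\<lambda>t. metric_mahler (ereal q) \<alpha> \<le> pnorm ms t) (at_left q)"
      using ev
    proof eventually_elim
      case (elim t)
      thus ?case using metric_mahler_antimono[of t q] eq[of t] assms(1) by simp
    qed
  qed simp
  show "pnorm ms q \<le> metric_mahler (ereal q) \<alpha>"
  proof (rule le_metric_mahler)
    fix \<beta>s assume \<beta>s: "\<beta>s \<in> factorizations \<alpha>"
    show "pnorm ms q \<le> pnorm (map mahler \<beta>s) q"
    proof (rule tendsto_le[OF _ lim lim])
      show "eventually (\<lambda>t. pnorm ms t \<le> pnorm (map mahler \<beta>s) t) (at_left q)"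
        using ev
      proof eventually_elim
        case (elim t)
        thus ?case using metric_mahler_le[OF \<beta>s, of t] eq[of t] by simp
      qed
    qed simp
  qed
qed

text \<open>For a measure m that is 0 or at least c, m^s c^(t-s) \<le> m^t. Summing over a
  factorization with gap gives a lower bound at \<open>t\<close> in terms of the value at
  \<open>s\<close>.\<close>

lemma metric_mahler_gap_bound:
  "\<exists>c>0. \<forall>s t. 0 < s \<longrightarrow> s \<le> t \<longrightarrow>
     (metric_mahler (ereal s) \<alpha> powr s * c powr (t - s)) powr (1 / t) \<le> metric_mahler (ereal t) \<alpha>"
proof -
  interpret algebraic_number \<alpha> by unfold_locales (rule alg)
  obtain c where "c > 0" and gap: "\<And>\<beta>s. \<beta>s \<in> factorizations \<alpha> \<Longrightarrow> \<exists>\<gamma>s\<in>factorizations \<alpha>.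
      (\<forall>t>0. (\<Sum>\<gamma>\<leftarrow>\<gamma>s. mahler \<gamma> powr t) \<le> (\<Sum>\<beta>\<leftarrow>\<beta>s. mahler \<beta> powr t)) \<and>
      (\<forall>\<gamma>\<in>set \<gamma>s. mahler \<gamma> = 0 \<or> mahler \<gamma> \<ge> c)"
    using factorization_with_gap[OF nz] by metis
  have "(metric_mahler (ereal s) \<alpha> powr s * c powr (t - s)) powr (1 / t) \<le> metric_mahler (ereal t) \<alpha>"
    if st: "0 < s" "s \<le> t" for s t
  proof (rule le_metric_mahler)
    fix \<beta>s assume \<beta>s: "\<beta>s \<in> factorizations \<alpha>"
    obtain \<gamma>s where \<gamma>s: "\<gamma>s \<in> factorizations \<alpha>"
      "\<And>t. t > 0 \<Longrightarrow> (\<Sum>\<gamma>\<leftarrow>\<gamma>s. mahler \<gamma> powr t) \<le> (\<Sum>\<beta>\<leftarrow>\<beta>s. mahler \<beta> powr t)"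
      "\<And>\<gamma>. \<gamma> \<in> set \<gamma>s \<Longrightarrow> mahler \<gamma> = 0 \<or> mahler \<gamma> \<ge> c"
      using gap[OF \<beta>s] by metis
    have "metric_mahler (ereal s) \<alpha> powr s \<le> pnorm (map mahler \<gamma>s) s powr s"
      using metric_mahler_le[OF \<gamma>s(1)] metric_mahler_nonneg st by (intro powr_mono2) auto
    also have "\<dots> = (\<Sum>\<gamma>\<leftarrow>\<gamma>s. mahler \<gamma> powr s)" using st by (simp add: pnorm_powr comp_def)
    finally have "metric_mahler (ereal s) \<alpha> powr s * c powr (t - s) \<le>
        (\<Sum>\<gamma>\<leftarrow>\<gamma>s. mahler \<gamma> powr s) * c powr (t - s)"
      by (intro mult_right_mono) auto
    also have "\<dots> = (\<Sum>\<gamma>\<leftarrow>\<gamma>s. mahler \<gamma> powr s * c powr (t - s))" by (simp add: sum_list_mult_const)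
    also have "\<dots> \<le> (\<Sum>\<gamma>\<leftarrow>\<gamma>s. mahler \<gamma> powr t)"
    proof (rule sum_list_mono)
      fix \<gamma> assume "\<gamma> \<in> set \<gamma>s"
      from \<gamma>s(3)[OF this] show "mahler \<gamma> powr s * c powr (t - s) \<le> mahler \<gamma> powr t"
      proof
        assume "mahler \<gamma> \<ge> c"
        hence "mahler \<gamma> powr s * c powr (t - s) \<le> mahler \<gamma> powr s * mahler \<gamma> powr (t - s)"
          using \<open>c > 0\<close> st by (intro mult_left_mono powr_mono2) auto
        thus ?thesis by (simp flip: powr_add)
      qed simp
    qed
    also have "\<dots> \<le> (\<Sum>\<beta>\<leftarrow>\<beta>s. mahler \<beta> powr t)" using st by (intro \<gamma>s(2)) simp
    finally show "(metric_mahler (ereal s) \<alpha> powr s * c powr (t - s)) powr (1 / t) \<le> pnorm (map mahler \<beta>s) t"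
      unfolding pnorm_def using st by (intro powr_mono2) (auto simp: comp_def)
  qed
  thus ?thesis using \<open>c > 0\<close> by blast
qed

text \<open>Monotonicity bounds \<open>pnorm ms\<close> to the right of \<open>p\<close>.
  Conversely, as t decreases to \<open>p\<close>, the lower bound of
  \<open>metric_mahler_gap_bound\<close> tends to the value at \<open>p\<close>.\<close>

lemma metric_mahler_left_endpoint:
  assumes "0 < p" and "p < q"
    and eq: "\<And>t. p < t \<Longrightarrow> t < q \<Longrightarrow> metric_mahler (ereal t) \<alpha> = pnorm ms t"
  shows "metric_mahler (ereal p) \<alpha> = pnorm ms p"
proof (rule antisym)
  let ?M = "metric_mahler (ereal p) \<alpha>"
  have ev: "eventually (\<lambda>t. p < t \<and> t < q) (at_right p)"
    using eventually_at_right_real[OF assms(2)] by (auto elim: eventually_mono)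
  note lim = tendsto_pnorm[OF assms(1), of ms "{p<..}"]
  show "pnorm ms p \<le> ?M"
  proof (rule tendsto_upperbound[OF lim])
    show "eventually (\<lambda>t. pnorm ms t \<le> ?M) (at_right p)"
      using ev
    proof eventually_elim
      case (elim t)
      thus ?case using metric_mahler_antimono[OF assms(1), of t] eq[of t] by simp
    qed
  qed simp
  show "?M \<le> pnorm ms p"
  \<comment> \<open>A nonzero base is needed for the limit of the outer \<open>powr\<close>.\<close>
  proof (cases "?M = 0")
    case True
    thus ?thesis by (simp add: pnorm_nonneg)
  next
    case False
    hence M: "?M > 0" using metric_mahler_nonneg[of p] by linarith
    obtain c where c: "c > 0" "\<And>t. p \<le> t \<Longrightarrow>
        (?M powr p * c powr (t - p)) powr (1 / t) \<le> metric_mahler (ereal t) \<alpha>"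
      using metric_mahler_gap_bound assms(1) by metis
    have "((\<lambda>t. (?M powr p * c powr (t - p)) powr (1 / t)) \<longlongrightarrow>
        (?M powr p * c powr (p - p)) powr (1 / p)) (at_right p)"
      using M c(1) assms(1) by (intro tendsto_intros) auto
    also have "(?M powr p * c powr (p - p)) powr (1 / p) = ?M"
      using M c(1) assms(1) by (simp add: powr_powr)
    finally show ?thesis
    proof (rule tendsto_le[OF _ lim, rotated])
      show "eventually (\<lambda>t. (?M powr p * c powr (t - p)) powr (1 / t) \<le> pnorm ms t) (at_right p)"
        using ev
      proof eventually_elim
        case (elim t)
        thus ?case using c(2)[of t] eq[of t] by simp
      qed
    qed simp
  qed
qed

section \<open>Gluing local representations on an open interval\<close>

lemma standard_pointD:
  assumes "standard_point \<alpha> (ereal s)"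
  shows "\<exists>x V. x \<in> fin_seqs \<and> open V \<and> s \<in> V \<and> V \<subseteq> {0<..} \<and>
    (\<forall>t\<in>V. metric_mahler (ereal t) \<alpha> = pnorm (abs_list x) t)"
proof -
  obtain U x where U: "open U" "ereal s \<in> U" "U \<subseteq> {0<..}" "x \<in> fin_seqs"
    "\<And>t. t \<in> U \<Longrightarrow> metric_mahler t \<alpha> = seq_norm t x"
    using assms by (auto simp: standard_point_def uniform_set_def)
  have "open (ereal -` U)" using U(1) by (intro open_vimage continuous_intros)
  thus ?thesis
    using U by (intro exI[of _ x] exI[of _ "ereal -` U"]) (auto simp: seq_norm_conv_pnorm)
qed

text \<open>The sequences chosen at different points may differ, but on overlapping neighborhoods
  their norm functions agree, hence agree everywhere by \<open>pnorm_eq_analytic\<close>. The norm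
  function is thus locally constant in the chosen point, and the interval is connected.\<close>

lemma standard_interval:
  assumes "0 \<le> p" and "p < q" and std: "\<And>s. p < s \<Longrightarrow> s < q \<Longrightarrow> standard_point \<alpha> (ereal s)"
  shows "\<exists>x\<in>fin_seqs. \<forall>t. p < t \<longrightarrow> t < q \<longrightarrow> metric_mahler (ereal t) \<alpha> = pnorm (abs_list x) t"
proof -
  let ?S = "{p<..<q}"
  have "\<forall>s\<in>?S. \<exists>x V. x \<in> fin_seqs \<and> open V \<and> s \<in> V \<and> V \<subseteq> {0<..} \<and>
    (\<forall>t\<in>V. metric_mahler (ereal t) \<alpha> = pnorm (abs_list x) t)"
    using std standard_pointD by simp
  then obtain x V where "\<forall>s\<in>?S. x s \<in> fin_seqs \<and> open (V s) \<and> s \<in> V s \<and> V s \<subseteq> {0<..} \<and>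
      (\<forall>t\<in>V s. metric_mahler (ereal t) \<alpha> = pnorm (abs_list (x s)) t)"
    unfolding bchoice_iff by (elim exE)
  hence xV: "\<And>s. s \<in> ?S \<Longrightarrow> x s \<in> fin_seqs" "\<And>s. s \<in> ?S \<Longrightarrow> open (V s)"
      "\<And>s. s \<in> ?S \<Longrightarrow> s \<in> V s" "\<And>s. s \<in> ?S \<Longrightarrow> V s \<subseteq> {0<..}"
      "\<And>s t. s \<in> ?S \<Longrightarrow> t \<in> V s \<Longrightarrow> metric_mahler (ereal t) \<alpha> = pnorm (abs_list (x s)) t"
    by blast+
  have loc: "pnorm (abs_list (x s)) = pnorm (abs_list (x u))" if su: "s \<in> ?S" "u \<in> V s \<inter> ?S" for s u
  proof -
    have "open (V s \<inter> V u)" "u \<in> V s \<inter> V u" using xV su by auto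
    then obtain e where e: "e > 0" "ball u e \<subseteq> V s \<inter> V u" by (meson open_contains_ball)
    have "u > 0" using xV(4) su by auto
    have "pnorm (abs_list (x s)) t = pnorm (abs_list (x u)) t" for t
    proof (rule pnorm_eq_analytic)
      show "u < u + e" using e by simp
      fix t assume "u < t" "t < u + e"
      hence "t \<in> ball u e" by (simp add: dist_real_def)
      hence "t \<in> V s" "t \<in> V u" using e by auto
      thus "pnorm (abs_list (x s)) t = pnorm (abs_list (x u)) t" using xV(5) su by (metis IntD2)
    qed (use \<open>u > 0\<close> abs_list_nonneg in auto)
    thus ?thesis by auto
  qed
  have all: "pnorm (abs_list (x s)) = pnorm (abs_list (x u))" if "s \<in> ?S" "u \<in> ?S" for s u
  proof (rule connected_equivalence_relation[of ?S s u "\<lambda>s u. pnorm (abs_list (x s)) = pnorm (abs_list (x u))"])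
    fix s assume s: "s \<in> ?S"
    show "\<exists>T. openin (top_of_set ?S) T \<and> s \<in> T \<and>
        (\<forall>u\<in>T. pnorm (abs_list (x s)) = pnorm (abs_list (x u)))"
    proof (intro exI[of _ "?S \<inter> V s"] conjI ballI)
      show "openin (top_of_set ?S) (?S \<inter> V s)" by (rule openin_open_Int[OF xV(2)[OF s]])
      show "s \<in> ?S \<inter> V s" using s xV(3)[OF s] by blast
      show "pnorm (abs_list (x s)) = pnorm (abs_list (x u))" if "u \<in> ?S \<inter> V s" for u
        using that by (intro loc[OF s]) blast
    qed
  qed (use that in \<open>simp_all add: convex_connected\<close>)
  define s where "s = (p + q) / 2"
  have s: "s \<in> ?S" using assms(2) by (simp add: s_def)
  show ?thesis
  proof (intro bexI[of _ "x s"] allI impI)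
    fix t assume "p < t" "t < q"
    hence t: "t \<in> ?S" by simp
    show "metric_mahler (ereal t) \<alpha> = pnorm (abs_list (x s)) t"
      using xV(5)[OF t xV(3)[OF t]] all[OF s t] by simp
  qed (use xV(1) s in auto)
qed

end

lemma uniform_imp_standard:
  assumes "uniform_set \<alpha> I" and "open U" and "U \<subseteq> I" and "s \<in> U"
  shows "standard_point \<alpha> s"
  using assms unfolding standard_point_def uniform_set_def by blast

theorem theorem1p4:
  fixes \<alpha> :: complex and a b :: real
  assumes "algebraic \<alpha>" and "\<alpha> \<noteq> 0" and "0 < a" and "a < b"
  shows "(uniform_set \<alpha> {ereal a..ereal b} \<longleftrightarrow>
            (\<forall>s\<in>{ereal a<..<ereal b}. standard_point \<alpha> s)) \<and>
         (uniform_set \<alpha> {0<..ereal a} \<longleftrightarrow>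
            (\<forall>s\<in>{0<..<ereal a}. standard_point \<alpha> s))"
proof (intro conjI iffI ballI)
  fix s assume "uniform_set \<alpha> {ereal a..ereal b}" "s \<in> {ereal a<..<ereal b}"
  thus "standard_point \<alpha> s"
    by (intro uniform_imp_standard[of \<alpha> "{ereal a..ereal b}" "{ereal a<..<ereal b}"]) auto
next
  fix s assume "uniform_set \<alpha> {0<..ereal a}" "s \<in> {0<..<ereal a}"
  thus "standard_point \<alpha> s"
    by (intro uniform_imp_standard[of \<alpha> "{0<..ereal a}" "{0<..<ereal a}"]) auto
next
  assume std: "\<forall>s\<in>{ereal a<..<ereal b}. standard_point \<alpha> s"
  obtain x where x: "x \<in> fin_seqs"
    "\<And>t. a < t \<Longrightarrow> t < b \<Longrightarrow> metric_mahler (ereal t) \<alpha> = pnorm (abs_list x) t"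
    using standard_interval[OF assms(1,2), of a b] assms(3,4) std by auto
  \<comment> \<open>The representation on the open interval extends to both end points by
    continuity.\<close>
  have "metric_mahler (ereal t) \<alpha> = pnorm (abs_list x) t" if "a \<le> t" "t \<le> b" for t
    using metric_mahler_right_endpoint[OF assms(1,2) _ assms(4) x(2)]
      metric_mahler_left_endpoint[OF assms(1-4) x(2)] x(2)[of t] that assms(3)
    by (cases "t = a"; cases "t = b") auto
  hence "metric_mahler t \<alpha> = seq_norm t x" if "t \<in> {ereal a..ereal b}" for t
    using that by (cases t) (auto simp: seq_norm_conv_pnorm[OF x(1)])
  moreover have "{ereal a..ereal b} \<subseteq> {0<..}" using assms(3) by (auto intro: less_le_trans[of _ "ereal a"])
  ultimately show "uniform_set \<alpha> {ereal a..ereal b}"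
    using x(1) by (auto simp: uniform_set_def)
next
  assume std: "\<forall>s\<in>{0<..<ereal a}. standard_point \<alpha> s"
  obtain x where x: "x \<in> fin_seqs"
    "\<And>t. 0 < t \<Longrightarrow> t < a \<Longrightarrow> metric_mahler (ereal t) \<alpha> = pnorm (abs_list x) t"
    using standard_interval[OF assms(1,2), of 0 a] assms(3) std by auto
  \<comment> \<open>The end point 0 is not in the set, so only continuity from the left at
    \<open>a\<close> is called for.\<close>
  have "metric_mahler (ereal t) \<alpha> = pnorm (abs_list x) t" if "0 < t" "t \<le> a" for t
    using metric_mahler_right_endpoint[OF assms(1,2) order.refl assms(3) x(2)] x(2)[of t] that
    by (cases "t = a") auto
  hence "metric_mahler t \<alpha> = seq_norm t x" if "t \<in> {0<..ereal a}" for t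
    using that by (cases t) (auto simp: seq_norm_conv_pnorm[OF x(1)])
  thus "uniform_set \<alpha> {0<..ereal a}"
    using x(1) by (auto simp: uniform_set_def)
qed

end
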